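(* Fix the data $z$. Assume: (1) the function $\theta\mapsto \ell(\theta)$ is finite everywhere on $\mathbb{R}^d$, convex, and twice continuously differentiable; (2) for all $\delta\in\Delta$, the function $\theta\mapsto P(\theta\vert\delta)$ is convex, lower semi-continuous, not identically $+\infty$, and admits a sub-gradient $g(\theta\vert\delta)$ at $\theta$, for all $\theta\in\mathbb{R}^d_\delta$. Suppose that there exists $\gamma_0>0$ such that $\check\Pi_{\gamma_0}(\cdot\vert z)$ is well-defined. Then for all $\gamma\in(0,\gamma_0]$, $\check\Pi_\gamma(\cdot\vert z)$ is well-defined and $$\mathsf{d}_\beta\left(\check\Pi_\gamma(\cdot\vert z),\check\Pi(\cdot\vert z)\right)\le \sqrt{\gamma d}+2\left(1-e^{-\varrho_\gamma(z)}\right).$$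
   Context: Let $d\ge1$ be an integer and $\Delta=\{0,1\}^d$. For $\theta,\vartheta\in\mathbb{R}^d$, $\theta\cdot\vartheta$ is the component-wise product; for $\delta\in\Delta$, $\theta_\delta=\theta\cdot\delta$ and $\mathbb{R}^d_\delta=\{\theta\in\mathbb{R}^d:\theta_j=0 \text{ whenever } \delta_j=0\}$. $\|\cdot\|$ and $\langle\cdot,\cdot\rangle$ are the Euclidean norm and inner product, and $\|\cdot\|_0$ is the number of non-zero components. The measure $\mu_\delta(d\theta)=\prod_{j=1}^d\nu_{\delta_j}(d\theta_j)$, where $\nu_0$ is the Dirac mass at $0$ and $\nu_1$ is Lebesgue measure on $\mathbb{R}$. Conventions: $e^{-\infty}=0$, $0\times\infty=0$. Model: $z$ is fixed data with likelihood $f_\theta(z)$, $\theta\in\mathbb{R}^d$; $\ell(\theta)=-\log f_\theta(z)$. $\{\pi_\delta,\delta\in\Delta\}$ is a probability distribution on $\Delta$, and $p$ is a positive probability density on $\mathbb{R}$. Define $P(\theta\vert\delta)=-\sum_{j:\delta_j=1}\log p(\theta_j)$ if $\theta\in\mathbb{R}^d_\delta$ and $P(\theta\vert\delta)=+\infty$ otherwise, and $h(\theta\vert\delta)=\ell(\theta)+P(\theta\vert\delta)$. Posterior distribution on $\Delta\times\mathbb{R}^d$: $\check\Pi(\delta,d\theta\vert z)\propto \pi_\delta e^{-h(\theta\vert\delta)}\mu_\delta(d\theta)$. For $\gamma>0$ let $$h_\gamma(\theta\vert\delta)=\min_{u\in\mathbb{R}^d}\left[\ell(\theta)+\langle\nabla\ell(\theta),u-\theta\rangle+P(u\vert\delta)+\frac{1}{2\gamma}\|u-\theta\|^2\right],$$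 and let $\check\Pi_\gamma(\delta,d\theta\vert z)\propto\pi_\delta(2\pi\gamma)^{\|\delta\|_0/2}e^{-h_\gamma(\theta\vert\delta)}d\theta$ (here $\pi$ without subscript is the number $3.14\ldots$); it is well-defined when its normalizing constant $\sum_\delta \pi_\delta(2\pi\gamma)^{\|\delta\|_0/2}\int_{\mathbb{R}^d}e^{-h_\gamma(\theta\vert\delta)}d\theta$ is finite. Let $\tilde\Pi_\gamma$ be the probability measure on $\Delta\times\mathbb{R}^d$ given by $$\tilde\Pi_\gamma(\delta,d\theta\vert z)\propto\pi_\delta\left(\frac{1}{2\pi\gamma}\right)^{\frac{d-\|\delta\|_0}{2}}e^{-\frac{1}{2\gamma}\|\theta-\theta_\delta\|^2}e^{-h(\theta_\delta\vert\delta)}d\theta,$$ and set $$r_\gamma(\delta,\theta)=\langle\nabla\ell(\theta)-\nabla\ell(\theta_\delta),\theta-\theta_\delta\rangle+\frac{\gamma}{2}\|\delta\cdot\nabla\ell(\theta)+\delta\cdot g(\theta_\delta\vert\delta)\|^2,\qquad \varrho_\gamma(z)=\log\int e^{r_\gamma(\delta,\theta)}\tilde\Pi_\gamma(d\delta,d\theta\vert z).$$ ($\varrho_\gamma(z)\in[0,+\infty]$.) The space $\Delta\times\mathbb{R}^d$ carries the metric $\sqrt{\|\delta_1-\delta_2\|_0^2+\|\theta_1-\theta_2\|^2}$. On a separable complete metric space, $\mathsf{d}_\beta(\mu_1,\mu_2)=\sup|\int f d\mu_1-\int f d\mu_2|$, the supremum over measurable real $f$ with $\|f\|_\infty+\|f\|_{\mathsf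 L}\le1$, where $\|f\|_\infty=\sup|f|$ and $\|f\|_{\mathsf L}$ is the Lipschitz constant of $f$. *)

theory Defs
  imports "HOL-Probability.Probability"
begin

definition eexp :: "ereal \<Rightarrow> ennreal" where
  "eexp x = (if x = \<infinity> then \<infinity> else if x = -\<infinity> then 0 else ennreal (exp (real_of_ereal x)))"

definition elog :: "ennreal \<Rightarrow> ereal" where
  "elog x = (if x = 0 then -\<infinity> else if x = \<infinity> then \<infinity> else ereal (ln (enn2real x)))"

text \<open>\<^term>\<open>grad F x\<close> is meaningful only where \<^term>\<open>F\<close> is differentiable.\<close>

definition grad :: "('a::real_inner \<Rightarrow> real) \<Rightarrow> 'a \<Rightarrow> 'a" where
  "grad F x = (THE D. GDERIV F x :> D)"

definition twice_continuously_differentiable :: "('a::real_inner \<Rightarrow> real) \<Rightarrow> bool" where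
  "twice_continuously_differentiable F \<longleftrightarrow>
     (\<exists>G H. (\<forall>x. GDERIV F x :> G x) \<and>
            (\<forall>x. (G has_derivative blinfun_apply (H x)) (at x)) \<and>
            continuous_on UNIV (H :: 'a \<Rightarrow> 'a \<Rightarrow>\<^sub>L 'a))"

text \<open>In the following definition the convention \<^prop>\<open>(0::ereal) * \<infinity> = 0\<close> is in force.\<close>

definition ereal_convex :: "('a::real_vector \<Rightarrow> ereal) \<Rightarrow> bool" where
  "ereal_convex F \<longleftrightarrow>
     (\<forall>x y. \<forall>t\<in>{0..1}. F ((1 - t) *\<^sub>R x + t *\<^sub>R y) \<le> ereal (1 - t) * F x + ereal t * F y)"

definition lower_semicontinuous :: "('a::topological_space \<Rightarrow> ereal) \<Rightarrow> bool" where
  "lower_semicontinuous F \<longleftrightarrow> (\<forall>x. F x \<le> Liminf (at x) F)"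

definition is_subgradient :: "('a::real_inner \<Rightarrow> ereal) \<Rightarrow> 'a \<Rightarrow> 'a \<Rightarrow> bool" where
  "is_subgradient F x v \<longleftrightarrow> (\<forall>u. F x + ereal (v \<bullet> (u - x)) \<le> F u)"

text \<open>The index type \<^typ>\<open>'n\<close> plays the role of \<open>{1, ..., d}\<close>, so that \<open>d\<close> is \<open>CARD('n)\<close>.
  Multiplication on \<^typ>\<open>real ^ 'n\<close> is the component-wise product, hence \<open>\<theta>\<^sub>\<delta>\<close> is \<open>\<theta> * \<delta>\<close>.\<close>

definition Delta :: "(real ^ 'n) set" where
  "Delta = {\<delta>. \<forall>j. \<delta> $ j \<in> {0, 1}}"

definition norm0 :: "real ^ 'n \<Rightarrow> nat" where
  "norm0 x = card {j. x $ j \<noteq> 0}"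

definition Rsub :: "real ^ 'n \<Rightarrow> (real ^ 'n) set" where
  "Rsub \<delta> = {\<theta>. \<forall>j. \<delta> $ j = 0 \<longrightarrow> \<theta> $ j = 0}"

definition nu :: "real \<Rightarrow> real measure" where
  "nu a = (if a = 0 then return borel 0 else lborel)"

definition mu :: "real ^ 'n \<Rightarrow> (real ^ 'n) measure" where
  "mu \<delta> = distr (PiM UNIV (\<lambda>j. nu (\<delta> $ j))) borel (\<lambda>x. \<chi> j. x j)"

definition neg_loglik :: "(real ^ 'n \<Rightarrow> 'z \<Rightarrow> real) \<Rightarrow> 'z \<Rightarrow> real ^ 'n \<Rightarrow> real" where
  "neg_loglik f z \<theta> = - ln (f \<theta> z)"

definition penalty :: "(real \<Rightarrow> real) \<Rightarrow> real ^ 'n \<Rightarrow> real ^ 'n \<Rightarrow> ereal" where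
  "penalty p \<delta> \<theta> =
     (if \<theta> \<in> Rsub \<delta> then ereal (- (\<Sum>j | \<delta> $ j = 1. ln (p (\<theta> $ j)))) else \<infinity>)"

definition objective ::
  "(real ^ 'n \<Rightarrow> real) \<Rightarrow> (real \<Rightarrow> real) \<Rightarrow> real ^ 'n \<Rightarrow> real ^ 'n \<Rightarrow> ereal" where
  "objective l p \<delta> \<theta> = ereal (l \<theta>) + penalty p \<delta> \<theta>"

text \<open>The forward-backward envelope of \<^const>\<open>objective\<close>. When the penalty is convex, lower
  semicontinuous and proper, the infimum is attained.\<close>

definition envelope ::
  "(real ^ 'n \<Rightarrow> real) \<Rightarrow> (real \<Rightarrow> real) \<Rightarrow> real \<Rightarrow> real ^ 'n \<Rightarrow> real ^ 'n \<Rightarrow> ereal" where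
  "envelope l p \<gamma> \<delta> \<theta> =
     (INF u. ereal (l \<theta> + grad l \<theta> \<bullet> (u - \<theta>)) + penalty p \<delta> u
             + ereal (1 / (2 * \<gamma>) * (norm (u - \<theta>))\<^sup>2))"

definition normalize_measure :: "'a measure \<Rightarrow> 'a measure" where
  "normalize_measure M = scale_measure (inverse (emeasure M (space M))) M"

text \<open>The measure \<open>w \<delta> \<theta> m\<^sub>\<delta>(d\<theta>)\<close> on pairs \<open>(\<delta>, \<theta>)\<close>.\<close>

definition joint_measure ::
  "(real ^ 'n \<Rightarrow> (real ^ 'n) measure) \<Rightarrow> (real ^ 'n \<Rightarrow> real ^ 'n \<Rightarrow> ennreal)
     \<Rightarrow> ((real ^ 'n) \<times> (real ^ 'n)) measure" where
  "joint_measure m w =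
     measure_of (Delta \<times> UNIV) (sets (count_space Delta \<Otimes>\<^sub>M borel))
       (\<lambda>A. \<Sum>\<delta>\<in>Delta. \<integral>\<^sup>+ \<theta>. w \<delta> \<theta> * indicator A (\<delta>, \<theta>) \<partial>m \<delta>)"

definition posterior ::
  "(real ^ 'n \<Rightarrow> real) \<Rightarrow> (real \<Rightarrow> real) \<Rightarrow> (real ^ 'n \<Rightarrow> real)
     \<Rightarrow> ((real ^ 'n) \<times> (real ^ 'n)) measure" where
  "posterior l p prior =
     normalize_measure (joint_measure mu
       (\<lambda>\<delta> \<theta>. ennreal (prior \<delta>) * eexp (- objective l p \<delta> \<theta>)))"

definition posterior_env ::
  "(real ^ 'n \<Rightarrow> real) \<Rightarrow> (real \<Rightarrow> real) \<Rightarrow> (real ^ 'n \<Rightarrow> real) \<Rightarrow> real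
     \<Rightarrow> ((real ^ 'n) \<times> (real ^ 'n)) measure" where
  "posterior_env l p prior \<gamma> =
     normalize_measure (joint_measure (\<lambda>_. lborel)
       (\<lambda>\<delta> \<theta>. ennreal (prior \<delta> * (2 * pi * \<gamma>) powr (real (norm0 \<delta>) / 2))
               * eexp (- envelope l p \<gamma> \<delta> \<theta>)))"

definition posterior_env_well_defined ::
  "(real ^ 'n \<Rightarrow> real) \<Rightarrow> (real \<Rightarrow> real) \<Rightarrow> (real ^ 'n \<Rightarrow> real) \<Rightarrow> real \<Rightarrow> bool" where
  "posterior_env_well_defined l p prior \<gamma> \<longleftrightarrow>
     (\<Sum>\<delta>\<in>Delta. ennreal (prior \<delta> * (2 * pi * \<gamma>) powr (real (norm0 \<delta>) / 2))
        * (\<integral>\<^sup>+ \<theta>. eexp (- envelope l p \<gamma> \<delta> \<theta>) \<partial>lborel)) < \<infinity>"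

definition posterior_tilde ::
  "(real ^ 'n \<Rightarrow> real) \<Rightarrow> (real \<Rightarrow> real) \<Rightarrow> (real ^ 'n \<Rightarrow> real) \<Rightarrow> real
     \<Rightarrow> ((real ^ 'n) \<times> (real ^ 'n)) measure" where
  "posterior_tilde l p prior \<gamma> =
     normalize_measure (joint_measure (\<lambda>_. lborel)
       (\<lambda>\<delta> \<theta>. ennreal (prior \<delta>
                 * (1 / (2 * pi * \<gamma>)) powr ((real CARD('n) - real (norm0 \<delta>)) / 2)
                 * exp (- (1 / (2 * \<gamma>)) * (norm (\<theta> - \<theta> * \<delta>))\<^sup>2))
               * eexp (- objective l p \<delta> (\<theta> * \<delta>))))"

text \<open>The argument \<^term>\<open>g\<close> takes the sparsity pattern first: \<^term>\<open>g \<delta> \<theta>\<close> is a subgradient of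
  \<^term>\<open>penalty p \<delta>\<close> at \<^term>\<open>\<theta>\<close>.\<close>

definition remainder ::
  "(real ^ 'n \<Rightarrow> real) \<Rightarrow> (real ^ 'n \<Rightarrow> real ^ 'n \<Rightarrow> real ^ 'n) \<Rightarrow> real
     \<Rightarrow> real ^ 'n \<Rightarrow> real ^ 'n \<Rightarrow> real" where
  "remainder l g \<gamma> \<delta> \<theta> =
     (grad l \<theta> - grad l (\<theta> * \<delta>)) \<bullet> (\<theta> - \<theta> * \<delta>)
       + \<gamma> / 2 * (norm (\<delta> * grad l \<theta> + \<delta> * g \<delta> (\<theta> * \<delta>)))\<^sup>2"

definition varrho ::
  "(real ^ 'n \<Rightarrow> real) \<Rightarrow> (real \<Rightarrow> real) \<Rightarrow> (real ^ 'n \<Rightarrow> real)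
     \<Rightarrow> (real ^ 'n \<Rightarrow> real ^ 'n \<Rightarrow> real ^ 'n) \<Rightarrow> real \<Rightarrow> ereal" where
  "varrho l p prior g \<gamma> =
     elog (\<integral>\<^sup>+ (\<delta>, \<theta>). ennreal (exp (remainder l g \<gamma> \<delta> \<theta>)) \<partial>posterior_tilde l p prior \<gamma>)"

definition sup_norm_on :: "'a set \<Rightarrow> ('a \<Rightarrow> real) \<Rightarrow> ennreal" where
  "sup_norm_on S f = (SUP x\<in>S. ennreal \<bar>f x\<bar>)"

definition lipschitz_const :: "('a \<Rightarrow> 'a \<Rightarrow> real) \<Rightarrow> 'a set \<Rightarrow> ('a \<Rightarrow> real) \<Rightarrow> ennreal" where
  "lipschitz_const dst S f =
     (SUP (x, y)\<in>{(x, y). x \<in> S \<and> y \<in> S \<and> x \<noteq> y}. ennreal (\<bar>f x - f y\<bar> / dst x y))"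

definition bounded_lipschitz_dist ::
  "('a \<Rightarrow> 'a \<Rightarrow> real) \<Rightarrow> 'a measure \<Rightarrow> 'a measure \<Rightarrow> ereal" where
  "bounded_lipschitz_dist dst M N =
     (SUP f\<in>{f \<in> borel_measurable M.
               sup_norm_on (space M) f + lipschitz_const dst (space M) f \<le> 1}.
        ereal \<bar>integral\<^sup>L M f - integral\<^sup>L N f\<bar>)"

definition pair_dist :: "(real ^ 'n) \<times> (real ^ 'n) \<Rightarrow> (real ^ 'n) \<times> (real ^ 'n) \<Rightarrow> real" where
  "pair_dist x y = sqrt ((real (norm0 (fst x - fst y)))\<^sup>2 + (norm (snd x - snd y))\<^sup>2)"

end

theory Submission
  imports Defs
begin

text \<open>
  The bridge between the two posteriors is the measure \<^const>\<open>posterior_tilde\<close>, and the two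
  summands of the bound estimate its distances to them.

  Under \<^const>\<open>posterior_tilde\<close> the pair \<open>(\<delta>, \<theta> * \<delta>)\<close> has exactly the law
  \<^const>\<open>posterior\<close>, because given \<open>\<delta>\<close> the coordinates of \<open>\<theta>\<close> off the pattern are centred Gaussians of
  variance \<open>\<gamma>\<close>, independent of each other and of the remaining coordinates (\<open>joint_measure_mu_eq_distr\<close>). This coupling
  moves a point by \<open>norm (\<theta> - \<theta> * \<delta>)\<close>, whose second moment is at most \<open>\<gamma> d\<close>, and a test function
  is \<open>1\<close>-Lipschitz; hence the summand \<open>sqrt (\<gamma> d)\<close>.

  The unnormalised densities \<open>u\<close> of \<^const>\<open>posterior_tilde\<close> and \<open>v\<close> of \<^const>\<open>posterior_env\<close>
  satisfy, up to a common constant, \<open>u \<le> v \<le> u * exp r\<close> with \<open>r\<close> the remainder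
  (\<open>weights_sandwich\<close>). The lower bound tries \<open>\<theta> * \<delta>\<close> in the infimum that defines the envelope and
  uses convexity of the negative log-likelihood. The upper bound replaces both convex functions by
  their tangents at \<open>\<theta> * \<delta>\<close> and minimises the resulting quadratic in closed form. After
  normalisation the first inequality says that \<^const>\<open>posterior_env\<close> dominates \<open>t\<close> times
  \<^const>\<open>posterior_tilde\<close>, where \<open>t\<close> is the ratio of the normalising constants, and the second
  says \<open>t \<ge> exp (- \<rho>)\<close> with \<open>\<rho>\<close> the quantity \<^const>\<open>varrho\<close> (\<open>density_sandwich_minorant\<close>). Two
  probability measures in such a relation give functions bounded by \<open>1\<close> expectations that differ
  by at most \<open>2 * (1 - t)\<close> (\<open>expectation_diff_le_of_minorant\<close>).

  That the envelope posterior is well defined for smaller \<open>\<gamma>\<close> is monotonicity: the envelope grows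
  when \<open>\<gamma>\<close> decreases.
\<close>

section \<open>Sparsity patterns\<close>

lemma finite_Delta: "finite (Delta :: (real ^ 'n) set)"
proof -
  have "finite (PiE (UNIV :: 'n set) (\<lambda>_. {0, 1 :: real}))"
    by (simp add: finite_PiE)
  moreover have "Delta \<subseteq> vec_lambda ` PiE (UNIV :: 'n set) (\<lambda>_. {0, 1 :: real})"
  proof
    fix \<delta> :: "real ^ 'n" assume "\<delta> \<in> Delta"
    then have "vec_nth \<delta> \<in> PiE UNIV (\<lambda>_. {0, 1})" by (auto simp: Delta_def)
    then show "\<delta> \<in> vec_lambda ` PiE (UNIV :: 'n set) (\<lambda>_. {0, 1 :: real})"
      by (metis image_eqI vec_nth_inverse)
  qed
  ultimately show ?thesis by (meson finite_imageI finite_subset)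
qed

lemma Delta_cases: "\<delta> \<in> Delta \<Longrightarrow> \<delta> $ j = 0 \<or> \<delta> $ j = 1"
  by (auto simp: Delta_def)

lemma restrict_in_Rsub: "\<theta> * \<delta> \<in> Rsub \<delta>"
  by (simp add: Rsub_def)

lemma restrict_measurable [measurable]: "(\<lambda>\<theta>. \<theta> * \<delta>) \<in> borel_measurable (borel :: (real ^ 'n) measure)"
proof -
  have "(\<lambda>\<theta> :: real ^ 'n. \<theta> * \<delta>) = (\<lambda>\<theta>. \<chi> j. \<theta> $ j * \<delta> $ j)"
    by (simp add: fun_eq_iff vec_eq_iff)
  moreover have "continuous_on UNIV (\<lambda>\<theta> :: real ^ 'n. \<chi> j. \<theta> $ j * \<delta> $ j)"
    by (intro continuous_intros)
  ultimately show ?thesis by (simp add: borel_measurable_continuous_onI)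
qed

lemma component_measurable [measurable]: "(\<lambda>\<theta> :: real ^ 'n. \<theta> $ j) \<in> borel_measurable borel"
  by (intro borel_measurable_continuous_onI continuous_intros)

lemma measurable_vec_lambda:
  fixes N :: "'n::finite \<Rightarrow> real measure"
  assumes "\<And>j. sets (N j) = sets borel"
  shows "(\<lambda>x. \<chi> j. x j) \<in> PiM UNIV N \<rightarrow>\<^sub>M borel"
proof -
  have "(\<lambda>x. x j) \<in> borel_measurable (PiM UNIV N)" for j
  proof -
    have "(\<lambda>x. x j) \<in> PiM UNIV N \<rightarrow>\<^sub>M N j" by (rule measurable_component_singleton) simp
    then show ?thesis using measurable_cong_sets[OF refl assms[of j]] by blast
  qed
  then show ?thesis
    by (subst borel_measurable_euclidean_space) (auto simp: Basis_vec_def inner_axis)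
qed

section \<open>Measures on pairs of a pattern and a parameter\<close>

abbreviation pattern_space :: "((real ^ 'n) \<times> (real ^ 'n)) measure" where
  "pattern_space \<equiv> count_space Delta \<Otimes>\<^sub>M borel"

abbreviation pattern_lborel :: "((real ^ 'n) \<times> (real ^ 'n)) measure" where
  "pattern_lborel \<equiv> count_space Delta \<Otimes>\<^sub>M lborel"

lemma sets_pattern_lborel [simp]: "sets pattern_lborel = sets pattern_space"
  by (intro sets_pair_measure_cong) auto

lemma space_pattern_lborel [simp]: "space pattern_lborel = Delta \<times> UNIV"
  by (simp add: space_pair_measure)

lemma measurable_patternI:
  assumes "\<And>\<delta>. \<delta> \<in> Delta \<Longrightarrow> (\<lambda>\<theta>. F (\<delta>, \<theta>)) \<in> borel \<rightarrow>\<^sub>M N"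
  shows "F \<in> pattern_lborel \<rightarrow>\<^sub>M N"
  using assms by (intro measurable_pair_measure_countable1) (auto simp: finite_Delta countable_finite)

lemma measurable_patternD:
  assumes "F \<in> pattern_lborel \<rightarrow>\<^sub>M N" "\<delta> \<in> Delta"
  shows "(\<lambda>\<theta>. F (\<delta>, \<theta>)) \<in> borel \<rightarrow>\<^sub>M N"
  using measurable_compose[OF measurable_Pair1'[of \<delta> "count_space Delta" lborel] assms(1)] assms(2)
  by simp

lemma nn_integral_pattern:
  assumes "F \<in> borel_measurable pattern_lborel"
  shows "(\<integral>\<^sup>+ x. F x \<partial>pattern_lborel) = (\<Sum>\<delta>\<in>Delta. \<integral>\<^sup>+ \<theta>. F (\<delta>, \<theta>) \<partial>lborel)"
  using assms
  by (subst lborel.nn_integral_fst[symmetric])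
     (auto simp: nn_integral_count_space_finite finite_Delta)

text \<open>Identifying the set function with the measure of an existing \<open>N\<close> makes countable additivity
  automatic, so that it never has to be checked for the formula itself.\<close>

lemma joint_measure_eqI:
  assumes sets: "sets N = sets pattern_space"
    and eq: "\<And>A. A \<in> sets N \<Longrightarrow>
      emeasure N A = (\<Sum>\<delta>\<in>Delta. \<integral>\<^sup>+ \<theta>. w \<delta> \<theta> * indicator A (\<delta>, \<theta>) \<partial>m \<delta>)"
  shows "joint_measure m w = N"
proof -
  have sp: "space N = Delta \<times> UNIV"
    using sets_eq_imp_space_eq[OF sets] by (simp add: space_pair_measure)
  have "joint_measure m w = measure_of (space N) (sets N)
       (\<lambda>A. \<Sum>\<delta>\<in>Delta. \<integral>\<^sup>+ \<theta>. w \<delta> \<theta> * indicator A (\<delta>, \<theta>) \<partial>m \<delta>)"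
    unfolding joint_measure_def sp sets ..
  also have "\<dots> = measure_of (space N) (sets N) (emeasure N)"
    by (intro measure_of_eq) (auto simp: sets.space_closed sets.sigma_sets_eq eq)
  finally show ?thesis by (simp add: measure_of_of_measure)
qed

lemma joint_measure_lborel:
  assumes w: "\<And>\<delta>. \<delta> \<in> Delta \<Longrightarrow> w \<delta> \<in> borel_measurable borel"
  shows "joint_measure (\<lambda>_. lborel) w = density pattern_lborel (\<lambda>(\<delta>, \<theta>). w \<delta> \<theta>)"
proof (rule joint_measure_eqI)
  have w': "(\<lambda>(\<delta>, \<theta>). w \<delta> \<theta>) \<in> borel_measurable pattern_lborel"
    by (rule measurable_patternI) (simp add: w)
  fix A assume "A \<in> sets (density pattern_lborel (\<lambda>(\<delta>, \<theta>). w \<delta> \<theta>))"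
  then have A: "A \<in> sets pattern_lborel" by simp
  then show "emeasure (density pattern_lborel (\<lambda>(\<delta>, \<theta>). w \<delta> \<theta>)) A
      = (\<Sum>\<delta>\<in>Delta. \<integral>\<^sup>+ \<theta>. w \<delta> \<theta> * indicator A (\<delta>, \<theta>) \<partial>lborel)"
    using w' by (simp add: emeasure_density nn_integral_pattern)
qed simp

section \<open>The reference measures as projections of Lebesgue measure\<close>

lemma lborel_eq_distr_PiM:
  "(lborel :: (real ^ 'n) measure) = distr (PiM UNIV (\<lambda>_. lborel)) borel (\<lambda>x. \<chi> j. x j)"
proof (rule lborel_eqI)
  interpret product_sigma_finite "\<lambda>_ :: 'n. lborel :: real measure" by standard
  fix l u :: "real ^ 'n"
  assume le: "\<And>b. b \<in> Basis \<Longrightarrow> l \<bullet> b \<le> u \<bullet> b"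
  then have le': "l $ j \<le> u $ j" for j
    by (metis axis_in_Basis_iff inner_axis inner_real_def mult.right_neutral Basis_real_def insertI1)
  have "(\<lambda>x. \<chi> j. x j) -` box l u \<inter> space (PiM UNIV (\<lambda>_. lborel :: real measure))
      = PiE UNIV (\<lambda>j. {l $ j <..< u $ j})"
    by (auto simp: space_PiM mem_box_cart PiE_iff)
  moreover have "(\<Prod>j\<in>UNIV. ennreal (u $ j - l $ j)) = ennreal (\<Prod>b\<in>Basis. (u - l) \<bullet> b)"
  proof -
    have Basis_eq: "(Basis :: (real ^ 'n) set) = range (\<lambda>j. axis j 1)"
      by (auto simp: Basis_vec_def)
    have inj: "inj (\<lambda>j :: 'n. axis j (1 :: real))"
      by (auto simp: inj_def axis_eq_axis)
    have "(\<Prod>b\<in>Basis. (u - l) \<bullet> b) = (\<Prod>j\<in>UNIV. u $ j - l $ j)"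
      unfolding Basis_eq by (simp add: prod.reindex[OF inj] inner_axis)
    then show ?thesis using le' by (simp add: prod_ennreal)
  qed
  ultimately show "emeasure (distr (PiM UNIV (\<lambda>_. lborel)) borel (\<lambda>x. \<chi> j. x j)) (box l u)
      = ennreal (\<Prod>b\<in>Basis. (u - l) \<bullet> b)"
    using le' by (simp add: emeasure_distr measurable_vec_lambda emeasure_PiM)
qed simp

text \<open>Spreading the Dirac masses of \<^term>\<open>mu \<delta>\<close> along arbitrary probability densities \<open>q j\<close> is undone by
  the projection \<open>\<theta> \<mapsto> \<theta> * \<delta>\<close>. Both sides are product measures, so this can be checked coordinate by
  coordinate: \<open>x \<mapsto> x * 0\<close> sends a probability measure to the Dirac mass at \<open>0\<close>, and \<open>x \<mapsto> x * 1\<close>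
  leaves Lebesgue measure alone. The freedom in \<open>q\<close> is what later yields second moments at no cost.\<close>

lemma mu_eq_distr_density:
  fixes \<delta> :: "real ^ 'n"
  assumes \<delta>: "\<delta> \<in> Delta"
    and q [measurable]: "\<And>j. q j \<in> borel_measurable (borel :: real measure)"
    and prob: "\<And>j. \<delta> $ j = 0 \<Longrightarrow> (\<integral>\<^sup>+ x. q j x \<partial>lborel) = 1"
  shows "mu \<delta> = distr (density lborel (\<lambda>\<theta>. \<Prod>j | \<delta> $ j = 0. q j (\<theta> $ j))) borel (\<lambda>\<theta>. \<theta> * \<delta>)"
proof -
  define N :: "'n \<Rightarrow> real measure" where "N j = (if \<delta> $ j = 0 then density lborel (q j) else lborel)" for j
  define Q :: "('n \<Rightarrow> real) \<Rightarrow> ennreal" where "Q x = (\<Prod>j | \<delta> $ j = 0. q j (x j))" for x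
  have sets_N [simp]: "sets (N j) = sets borel" for j by (simp add: N_def)
  have sets_nu [simp]: "sets (nu a) = sets borel" for a by (simp add: nu_def)
  interpret L: product_sigma_finite "\<lambda>_ :: 'n. lborel :: real measure" by standard
  have "sigma_finite_measure (N j)" for j
  proof (cases "\<delta> $ j = 0")
    case True
    then have "prob_space (N j)"
      by (intro prob_spaceI) (simp add: N_def emeasure_density prob)
    then show ?thesis
      by (simp add: prob_space_def finite_measure_def)
  qed (simp add: N_def lborel.sigma_finite_measure_axioms)
  then interpret N: product_sigma_finite N by (rule product_sigma_finite.intro)
  have "sigma_finite_measure (nu (\<delta> $ j))" for j
  proof (cases "\<delta> $ j = 0")
    case True
    then show ?thesis
      using prob_space_return[of 0 "borel :: real measure"]
      by (simp add: nu_def prob_space_def finite_measure_def)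
  qed (simp add: nu_def lborel.sigma_finite_measure_axioms)
  then interpret nu: product_sigma_finite "\<lambda>j. nu (\<delta> $ j)" by (rule product_sigma_finite.intro)
  have Q: "Q \<in> borel_measurable (PiM UNIV (\<lambda>_. lborel))"
    unfolding Q_def by measurable
  \<comment> \<open>Before the projection: \<open>N\<close> has product density \<open>Q\<close>.\<close>
  have PN: "density (PiM UNIV (\<lambda>_. lborel)) Q = PiM UNIV N"
  proof (rule N.PiM_eqI)
    show "sets (density (PiM UNIV (\<lambda>_. lborel)) Q) = sets (PiM UNIV N)"
      by (simp cong: sets_PiM_cong)
    fix A :: "'n \<Rightarrow> real set" assume "\<And>j. j \<in> UNIV \<Longrightarrow> A j \<in> sets (N j)"
    then have A [measurable]: "A j \<in> sets borel" for j by simp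
    define q' where "q' j x = (if \<delta> $ j = 0 then q j x else 1) * indicator (A j) x" for j x
    have [measurable]: "q' j \<in> borel_measurable lborel" for j
      unfolding q'_def by (cases "\<delta> $ j = 0") simp_all
    have "Q x * indicator (PiE UNIV A) x = (\<Prod>j\<in>UNIV. q' j (x j))" for x
    proof -
      have "Q x = (\<Prod>j\<in>UNIV. if \<delta> $ j = 0 then q j (x j) else 1)"
        unfolding Q_def by (simp add: prod.If_cases)
      moreover have "indicator (PiE UNIV A) x = (\<Prod>j\<in>UNIV. indicator (A j) (x j) :: ennreal)"
        by (auto simp: indicator_def PiE_iff split: if_splits intro!: prod.neutral[symmetric])
      ultimately show ?thesis by (simp add: q'_def prod.distrib)
    qed
    moreover have "PiE UNIV A \<in> sets (PiM UNIV (\<lambda>_. lborel))"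
      by (intro sets_PiM_I_finite) auto
    ultimately have "emeasure (density (PiM UNIV (\<lambda>_. lborel)) Q) (PiE UNIV A)
        = (\<integral>\<^sup>+ x. (\<Prod>j\<in>UNIV. q' j (x j)) \<partial>PiM UNIV (\<lambda>_. lborel))"
      by (simp add: emeasure_density Q)
    also have "\<dots> = (\<Prod>j\<in>UNIV. \<integral>\<^sup>+ x. q' j x \<partial>lborel)"
      by (rule L.product_nn_integral_prod) auto
    also have "\<dots> = (\<Prod>j\<in>UNIV. emeasure (N j) (A j))"
      by (intro prod.cong refl) (auto simp: q'_def N_def emeasure_density)
    finally show "emeasure (density (PiM UNIV (\<lambda>_. lborel)) Q) (PiE UNIV A) =
      (\<Prod>j\<in>UNIV. emeasure (N j) (A j))" .
  qed simp
  define R :: "('n \<Rightarrow> real) \<Rightarrow> 'n \<Rightarrow> real" where "R x j = x j * \<delta> $ j" for x j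
  have R: "R \<in> PiM UNIV N \<rightarrow>\<^sub>M PiM UNIV (\<lambda>j. nu (\<delta> $ j))"
  proof (rule measurable_PiM_single')
    fix j
    have "(\<lambda>x. x j) \<in> PiM UNIV N \<rightarrow>\<^sub>M N j" by (rule measurable_component_singleton) simp
    then have "(\<lambda>x. x j) \<in> borel_measurable (PiM UNIV N)"
      using measurable_cong_sets[OF refl sets_N[of j]] by blast
    then have "(\<lambda>x. x j * \<delta> $ j) \<in> borel_measurable (PiM UNIV N)" by simp
    then show "(\<lambda>x. R x j) \<in> PiM UNIV N \<rightarrow>\<^sub>M nu (\<delta> $ j)"
      unfolding R_def using measurable_cong_sets[OF refl sets_nu[of "\<delta> $ j"]] by blast
  qed (auto simp: nu_def space_PiM)
  have Pnu: "distr (PiM UNIV N) (PiM UNIV (\<lambda>j. nu (\<delta> $ j))) R = PiM UNIV (\<lambda>j. nu (\<delta> $ j))"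
  proof (rule nu.PiM_eqI)
    fix A :: "'n \<Rightarrow> real set" assume A: "\<And>j. j \<in> UNIV \<Longrightarrow> A j \<in> sets (nu (\<delta> $ j))"
    \<comment> \<open>The coordinatewise preimage of \<open>A\<close> under \<open>R\<close>.\<close>
    define B where "B j = (if \<delta> $ j = 0 then if 0 \<in> A j then UNIV else {} else A j)" for j
    have B: "B j \<in> sets (N j)" for j using A[of j] by (simp add: B_def)
    have R_B: "R -` PiE UNIV A \<inter> space (PiM UNIV N) = PiE UNIV B"
    proof -
      have "(x j * \<delta> $ j \<in> A j) \<longleftrightarrow> x j \<in> B j" for x j
        using Delta_cases[OF \<delta>, of j] by (auto simp: B_def)
      then show ?thesis
        by (auto simp: R_def PiE_iff space_PiM N_def)
    qed
    have N_nu: "emeasure (N j) (B j) = emeasure (nu (\<delta> $ j)) (A j)" for j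
      using A[of j] prob[of j] by (auto simp: N_def nu_def B_def emeasure_density)
    have "PiE UNIV A \<in> sets (PiM UNIV (\<lambda>j. nu (\<delta> $ j)))"
      using A by (intro sets_PiM_I_finite) auto
    then have "emeasure (distr (PiM UNIV N) (PiM UNIV (\<lambda>j. nu (\<delta> $ j))) R) (PiE UNIV A)
        = emeasure (PiM UNIV N) (PiE UNIV B)"
      using R by (simp add: emeasure_distr R_B)
    also have "\<dots> = (\<Prod>j\<in>UNIV. emeasure (N j) (B j))"
      using B by (intro N.emeasure_PiM) auto
    finally show "emeasure (distr (PiM UNIV N) (PiM UNIV (\<lambda>j. nu (\<delta> $ j))) R) (PiE UNIV A)
        = (\<Prod>j\<in>UNIV. emeasure (nu (\<delta> $ j)) (A j))" by (simp add: N_nu)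
  qed simp_all
  have vec_N: "(\<lambda>x. \<chi> j. x j) \<in> PiM UNIV N \<rightarrow>\<^sub>M borel"
    by (rule measurable_vec_lambda) simp
  have vec_L: "(\<lambda>x. \<chi> j. x j) \<in> PiM UNIV (\<lambda>_ :: 'n. lborel :: real measure) \<rightarrow>\<^sub>M borel"
    by (rule measurable_vec_lambda) simp
  have "mu \<delta> = distr (PiM UNIV N) borel ((\<lambda>x. \<chi> j. x j) \<circ> R)"
    unfolding mu_def by (subst Pnu[symmetric], subst distr_distr) (auto intro: R measurable_vec_lambda)
  also have "(\<lambda>x. \<chi> j. x j) \<circ> R = (\<lambda>\<theta>. \<theta> * \<delta>) \<circ> (\<lambda>x. \<chi> j. x j)"
    by (auto simp: R_def vec_eq_iff)
  also have "distr (PiM UNIV N) borel \<dots> = distr (distr (PiM UNIV N) borel (\<lambda>x. \<chi> j. x j)) borel (\<lambda>\<theta>. \<theta> * \<delta>)"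
    by (rule distr_distr[symmetric]) (auto intro: vec_N)
  also have "distr (PiM UNIV N) borel (\<lambda>x. \<chi> j. x j)
      = density lborel (\<lambda>\<theta>. \<Prod>j | \<delta> $ j = 0. q j (\<theta> $ j))"
    unfolding PN[symmetric] lborel_eq_distr_PiM
    by (subst density_distr) (auto intro: vec_L simp: Q_def[abs_def])
  finally show ?thesis .
qed


section \<open>Gaussian noise off the pattern\<close>

definition noise_density :: "real \<Rightarrow> real ^ 'n \<Rightarrow> real ^ 'n \<Rightarrow> real" where
  "noise_density \<gamma> \<delta> \<theta> = (\<Prod>j | \<delta> $ j = 0. normal_density 0 (sqrt \<gamma>) (\<theta> $ j))"

lemma noise_density_nonneg: "0 \<le> noise_density \<gamma> \<delta> \<theta>"
  by (simp add: noise_density_def prod_nonneg)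

lemma noise_density_pos: "0 < \<gamma> \<Longrightarrow> 0 < noise_density \<gamma> \<delta> \<theta>"
  by (simp add: noise_density_def prod_pos normal_density_pos)

lemma noise_density_measurable [measurable]: "noise_density \<gamma> \<delta> \<in> borel_measurable borel"
  unfolding noise_density_def by measurable

lemma norm_off_pattern:
  assumes "\<delta> \<in> Delta"
  shows "(norm (\<theta> - \<theta> * \<delta>))\<^sup>2 = (\<Sum>j | \<delta> $ j = 0. (\<theta> $ j)\<^sup>2)"
proof -
  have "(norm (\<theta> - \<theta> * \<delta>))\<^sup>2 = (\<Sum>j\<in>UNIV. (\<theta> $ j - \<theta> $ j * \<delta> $ j)\<^sup>2)"
    unfolding power2_norm_eq_inner inner_vec_def by (simp add: power2_eq_square)
  also have "\<dots> = (\<Sum>j | \<delta> $ j = 0. (\<theta> $ j)\<^sup>2)"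
    using Delta_cases[OF assms] by (intro sum.mono_neutral_cong_right) fastforce+
  finally show ?thesis .
qed

lemma card_off_pattern: "real (card {j. \<delta> $ j = 0}) = real CARD('n) - real (norm0 (\<delta> :: real ^ 'n))"
proof -
  have "card ({j. \<delta> $ j = 0} \<union> {j. \<delta> $ j \<noteq> 0}) = card {j. \<delta> $ j = 0} + card {j. \<delta> $ j \<noteq> 0}"
    by (rule card_Un_disjoint) auto
  moreover have "{j. \<delta> $ j = 0} \<union> {j. \<delta> $ j \<noteq> 0} = UNIV" by auto
  ultimately show ?thesis by (simp add: norm0_def)
qed

lemma noise_density_eq:
  fixes \<delta> :: "real ^ 'n"
  assumes \<delta>: "\<delta> \<in> Delta" and \<gamma>: "0 < \<gamma>"
  shows "noise_density \<gamma> \<delta> \<theta>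
    = (1 / (2 * pi * \<gamma>)) powr ((real CARD('n) - real (norm0 \<delta>)) / 2)
        * exp (- (1 / (2 * \<gamma>)) * (norm (\<theta> - \<theta> * \<delta>))\<^sup>2)"
proof -
  have "normal_density 0 (sqrt \<gamma>) x = (1 / (2 * pi * \<gamma>)) powr (1 / 2) * exp (- (1 / (2 * \<gamma>)) * x\<^sup>2)" for x
    using \<gamma> by (simp add: normal_density_def powr_half_sqrt real_sqrt_divide)
  then have "noise_density \<gamma> \<delta> \<theta>
      = ((1 / (2 * pi * \<gamma>)) powr (1 / 2)) ^ card {j. \<delta> $ j = 0}
         * (\<Prod>j | \<delta> $ j = 0. exp (- (1 / (2 * \<gamma>)) * (\<theta> $ j)\<^sup>2))"
    by (simp add: noise_density_def prod.distrib)
  also have "(\<Prod>j | \<delta> $ j = 0. exp (- (1 / (2 * \<gamma>)) * (\<theta> $ j)\<^sup>2))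
      = exp (- (1 / (2 * \<gamma>)) * (norm (\<theta> - \<theta> * \<delta>))\<^sup>2)"
    by (simp add: norm_off_pattern[OF \<delta>] sum_distrib_left exp_sum flip: sum_negf sum_divide_distrib)
  also have "((1 / (2 * pi * \<gamma>)) powr (1 / 2)) ^ card {j. \<delta> $ j = 0}
      = (1 / (2 * pi * \<gamma>)) powr ((real CARD('n) - real (norm0 \<delta>)) / 2)"
    using \<gamma> by (simp add: powr_powr card_off_pattern flip: powr_realpow)
  finally show ?thesis .
qed

lemma nn_integral_normal_density: "0 < \<sigma> \<Longrightarrow> (\<integral>\<^sup>+ x. normal_density 0 \<sigma> x \<partial>lborel) = 1"
  by (simp add: nn_integral_eq_integral normal_density_nonneg)

lemma nn_integral_normal_second_moment:
  assumes "0 < \<sigma>"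
  shows "(\<integral>\<^sup>+ x. ennreal (x\<^sup>2 / \<sigma>\<^sup>2 * normal_density 0 \<sigma> x) \<partial>lborel) = 1"
proof -
  have "has_bochner_integral lborel (\<lambda>x. normal_density 0 \<sigma> x * x\<^sup>2) (\<sigma>\<^sup>2)"
    using normal_moment_even[OF assms, of 0 1] by (simp add: eval_nat_numeral)
  then have "has_bochner_integral lborel (\<lambda>x. inverse (\<sigma>\<^sup>2) * (normal_density 0 \<sigma> x * x\<^sup>2)) (inverse (\<sigma>\<^sup>2) * \<sigma>\<^sup>2)"
    by (rule has_bochner_integral_mult_right)
  then have "has_bochner_integral lborel (\<lambda>x. x\<^sup>2 / \<sigma>\<^sup>2 * normal_density 0 \<sigma> x) 1"
    using assms by (simp add: field_simps)
  then show ?thesis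
    by (subst nn_integral_eq_integral)
       (auto simp: has_bochner_integral_iff normal_density_nonneg)
qed

lemma nn_integral_mu:
  fixes \<delta> :: "real ^ 'n"
  assumes \<delta>: "\<delta> \<in> Delta" and \<gamma>: "0 < \<gamma>" and F [measurable]: "F \<in> borel_measurable borel"
  shows "(\<integral>\<^sup>+ \<theta>. F \<theta> \<partial>mu \<delta>) = (\<integral>\<^sup>+ \<theta>. ennreal (noise_density \<gamma> \<delta> \<theta>) * F (\<theta> * \<delta>) \<partial>lborel)"
proof -
  have "mu \<delta> = distr (density lborel (\<lambda>\<theta>. \<Prod>j | \<delta> $ j = 0. ennreal (normal_density 0 (sqrt \<gamma>) (\<theta> $ j))))
      borel (\<lambda>\<theta>. \<theta> * \<delta>)"
    using \<gamma> by (intro mu_eq_distr_density[OF \<delta>]) (auto simp: nn_integral_normal_density)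
  then have "mu \<delta> = distr (density lborel (\<lambda>\<theta>. ennreal (noise_density \<gamma> \<delta> \<theta>))) borel (\<lambda>\<theta>. \<theta> * \<delta>)"
    by (simp add: noise_density_def prod_ennreal normal_density_nonneg)
  then show ?thesis
    by (simp add: nn_integral_distr nn_integral_density)
qed

text \<open>If \<open>q\<close> is the density of a centred normal law of variance \<open>\<gamma>\<close>, then \<open>x\<^sup>2 / \<gamma> * q x\<close> is again a
  probability density. Using it for the single coordinate \<open>i\<close> turns the second moment of that
  coordinate into another instance of \<open>mu_eq_distr_density\<close>.\<close>

lemma nn_integral_mu_component:
  fixes \<delta> :: "real ^ 'n"
  assumes \<delta>: "\<delta> \<in> Delta" and \<gamma>: "0 < \<gamma>" and F [measurable]: "F \<in> borel_measurable borel"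
    and i: "\<delta> $ i = 0"
  shows "(\<integral>\<^sup>+ \<theta>. ennreal ((\<theta> $ i)\<^sup>2) * (ennreal (noise_density \<gamma> \<delta> \<theta>) * F (\<theta> * \<delta>)) \<partial>lborel)
      = ennreal \<gamma> * (\<integral>\<^sup>+ \<theta>. F \<theta> \<partial>mu \<delta>)"
proof -
  define q where "q j x = (if j = i then x\<^sup>2 / \<gamma> else 1) * normal_density 0 (sqrt \<gamma>) x" for j :: 'n and x :: real
  have q_nonneg: "0 \<le> q j x" for j x using \<gamma> by (simp add: q_def)
  have "mu \<delta> = distr (density lborel (\<lambda>\<theta>. \<Prod>j | \<delta> $ j = 0. ennreal (q j (\<theta> $ j)))) borel (\<lambda>\<theta>. \<theta> * \<delta>)"
  proof (rule mu_eq_distr_density[OF \<delta>])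
    show "(\<integral>\<^sup>+ x. ennreal (q j x) \<partial>lborel) = 1" for j
      using \<gamma> nn_integral_normal_second_moment[of "sqrt \<gamma>"]
      by (cases "j = i") (auto simp: q_def nn_integral_normal_density)
  qed (simp add: q_def)
  moreover have "(\<Prod>j | \<delta> $ j = 0. ennreal (q j (\<theta> $ j)))
      = ennreal ((\<theta> $ i)\<^sup>2 / \<gamma> * noise_density \<gamma> \<delta> \<theta>)" for \<theta>
  proof -
    have "(\<Prod>j | \<delta> $ j = 0. ennreal (q j (\<theta> $ j))) = ennreal (\<Prod>j | \<delta> $ j = 0. q j (\<theta> $ j))"
      by (rule prod_ennreal) (rule q_nonneg)
    also have "(\<Prod>j | \<delta> $ j = 0. q j (\<theta> $ j)) = (\<theta> $ i)\<^sup>2 / \<gamma> * noise_density \<gamma> \<delta> \<theta>"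
      using i by (simp add: q_def prod.distrib noise_density_def)
    finally show ?thesis .
  qed
  ultimately have "(\<integral>\<^sup>+ \<theta>. F \<theta> \<partial>mu \<delta>)
      = (\<integral>\<^sup>+ \<theta>. ennreal ((\<theta> $ i)\<^sup>2 / \<gamma> * noise_density \<gamma> \<delta> \<theta>) * F (\<theta> * \<delta>) \<partial>lborel)"
    by (simp add: nn_integral_distr nn_integral_density)
  then have "ennreal \<gamma> * (\<integral>\<^sup>+ \<theta>. F \<theta> \<partial>mu \<delta>)
      = (\<integral>\<^sup>+ \<theta>. ennreal \<gamma> * (ennreal ((\<theta> $ i)\<^sup>2 / \<gamma> * noise_density \<gamma> \<delta> \<theta>) * F (\<theta> * \<delta>)) \<partial>lborel)"
    by (simp add: nn_integral_cmult)
  also have "\<dots> = (\<integral>\<^sup>+ \<theta>. ennreal ((\<theta> $ i)\<^sup>2) * (ennreal (noise_density \<gamma> \<delta> \<theta>) * F (\<theta> * \<delta>)) \<partial>lborel)"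
  proof (intro nn_integral_cong)
    fix \<theta> :: "real ^ 'n"
    have "ennreal \<gamma> * ennreal ((\<theta> $ i)\<^sup>2 / \<gamma> * noise_density \<gamma> \<delta> \<theta>)
        = ennreal ((\<theta> $ i)\<^sup>2) * ennreal (noise_density \<gamma> \<delta> \<theta>)"
      using \<gamma> noise_density_nonneg[of \<gamma> \<delta> \<theta>] by (simp flip: ennreal_mult)
    then show "ennreal \<gamma> * (ennreal ((\<theta> $ i)\<^sup>2 / \<gamma> * noise_density \<gamma> \<delta> \<theta>) * F (\<theta> * \<delta>))
        = ennreal ((\<theta> $ i)\<^sup>2) * (ennreal (noise_density \<gamma> \<delta> \<theta>) * F (\<theta> * \<delta>))"
      by (metis mult.assoc)
  qed
  finally show ?thesis ..
qed

lemma nn_integral_mu_square_norm: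
  fixes \<delta> :: "real ^ 'n"
  assumes \<delta>: "\<delta> \<in> Delta" and \<gamma>: "0 < \<gamma>" and F [measurable]: "F \<in> borel_measurable borel"
  shows "(\<integral>\<^sup>+ \<theta>. ennreal ((norm (\<theta> - \<theta> * \<delta>))\<^sup>2) * (ennreal (noise_density \<gamma> \<delta> \<theta>) * F (\<theta> * \<delta>)) \<partial>lborel)
      = ennreal (\<gamma> * (real CARD('n) - real (norm0 \<delta>))) * (\<integral>\<^sup>+ \<theta>. F \<theta> \<partial>mu \<delta>)"
proof -
  have "(\<integral>\<^sup>+ \<theta>. ennreal ((norm (\<theta> - \<theta> * \<delta>))\<^sup>2) * (ennreal (noise_density \<gamma> \<delta> \<theta>) * F (\<theta> * \<delta>)) \<partial>lborel)
      = (\<integral>\<^sup>+ \<theta>. (\<Sum>j | \<delta> $ j = 0. ennreal ((\<theta> $ j)\<^sup>2) * (ennreal (noise_density \<gamma> \<delta> \<theta>) * F (\<theta> * \<delta>))) \<partial>lborel)"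
    by (simp add: norm_off_pattern[OF \<delta>] sum_distrib_right flip: sum_ennreal)
  also have "\<dots> = (\<Sum>j | \<delta> $ j = 0. ennreal \<gamma> * (\<integral>\<^sup>+ \<theta>. F \<theta> \<partial>mu \<delta>))"
    by (subst nn_integral_sum) (auto simp: nn_integral_mu_component[OF \<delta> \<gamma> F] intro!: sum.cong)
  also have "\<dots> = ennreal (\<gamma> * real (card {j. \<delta> $ j = 0})) * (\<integral>\<^sup>+ \<theta>. F \<theta> \<partial>mu \<delta>)"
    using \<gamma> by (simp add: ennreal_mult ennreal_of_nat_eq_real_of_nat mult_ac)
  finally show ?thesis by (simp add: card_off_pattern)
qed

section \<open>Bounds for the envelope\<close>

lemma grad_eqI:
  assumes "GDERIV F x :> D"
  shows "grad F x = D"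
  unfolding grad_def
proof (rule the_equality)
  fix D' assume "GDERIV F x :> D'"
  then have "(\<lambda>h. h \<bullet> D') = (\<lambda>h. h \<bullet> D)"
    using assms unfolding gderiv_def by (rule has_derivative_unique)
  then have "(D' - D) \<bullet> (D' - D) = 0"
    by (metis inner_diff_right cancel_comm_monoid_add_class.diff_cancel)
  then show "D' = D" by simp
qed fact

lemma C2_grad:
  assumes "twice_continuously_differentiable F"
  shows "GDERIV F x :> grad F x" "continuous_on UNIV (grad F)" "continuous_on UNIV F"
proof -
  obtain G H where G: "\<And>x. GDERIV F x :> G x"
    and H: "\<And>x. (G has_derivative blinfun_apply (H x)) (at x)"
    using assms unfolding twice_continuously_differentiable_def by blast
  have eq: "grad F = G" using grad_eqI[OF G] by blast
  show "GDERIV F x :> grad F x" using G eq by simp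
  show "continuous_on UNIV (grad F)"
    unfolding eq by (metis H continuous_at_imp_continuous_on has_derivative_continuous)
  show "continuous_on UNIV F"
    using G unfolding gderiv_def by (metis continuous_at_imp_continuous_on has_derivative_continuous)
qed

lemma convex_grad_inequality:
  fixes F :: "'a::real_inner \<Rightarrow> real"
  assumes cvx: "convex_on UNIV F" and grad: "GDERIV F x :> D"
  shows "F x + D \<bullet> (y - x) \<le> F y"
proof -
  define \<phi> where "\<phi> s = F (x + s *\<^sub>R (y - x))" for s :: real
  have "convex_on UNIV \<phi>"
  proof (rule convex_onI)
    fix t a b :: real assume "0 < t" "t < 1"
    moreover have "x + ((1 - t) *\<^sub>R a + t *\<^sub>R b) *\<^sub>R (y - x)
        = (1 - t) *\<^sub>R (x + a *\<^sub>R (y - x)) + t *\<^sub>R (x + b *\<^sub>R (y - x))"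
      by (simp add: algebra_simps)
    ultimately show "\<phi> ((1 - t) *\<^sub>R a + t *\<^sub>R b) \<le> (1 - t) * \<phi> a + t * \<phi> b"
      unfolding \<phi>_def using convex_onD[OF cvx, of t] by simp
  qed simp
  moreover have "(\<phi> has_field_derivative D \<bullet> (y - x)) (at 0)"
  proof -
    have "(F has_derivative (\<lambda>h. h \<bullet> D)) (at (x + 0 *\<^sub>R (y - x)))"
      using grad by (simp add: gderiv_def)
    then have "(\<phi> has_derivative (\<lambda>h. (h *\<^sub>R (y - x)) \<bullet> D)) (at 0)"
      unfolding \<phi>_def by (rule has_derivative_compose[rotated]) (auto intro!: derivative_eq_intros)
    then show ?thesis
      by (rule has_derivative_imp_has_field_derivative) (simp add: inner_commute)
  qed
  ultimately have "\<phi> 1 - \<phi> 0 \<ge> D \<bullet> (y - x) * (1 - 0)"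
    by (intro convex_on_imp_above_tangent[where A = UNIV]) auto
  then show ?thesis by (simp add: \<phi>_def)
qed

lemma penalty_Rsub:
  "\<theta> \<in> Rsub \<delta> \<Longrightarrow> penalty p \<delta> \<theta> = ereal (- (\<Sum>j | \<delta> $ j = 1. ln (p (\<theta> $ j))))"
  by (simp add: penalty_def)

text \<open>The point \<open>\<theta> * \<delta>\<close> competes in the infimum, and the linearisation of \<open>l\<close> at \<open>\<theta>\<close> lies
  below \<open>l\<close> there.\<close>

lemma envelope_le:
  fixes l :: "real ^ 'n \<Rightarrow> real"
  assumes cvx: "convex_on UNIV l" and grad: "GDERIV l \<theta> :> grad l \<theta>"
  shows "envelope l p \<gamma> \<delta> \<theta>
    \<le> objective l p \<delta> (\<theta> * \<delta>) + ereal (1 / (2 * \<gamma>) * (norm (\<theta> - \<theta> * \<delta>))\<^sup>2)"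
proof -
  have "envelope l p \<gamma> \<delta> \<theta> \<le> ereal (l \<theta> + grad l \<theta> \<bullet> (\<theta> * \<delta> - \<theta>)) + penalty p \<delta> (\<theta> * \<delta>)
             + ereal (1 / (2 * \<gamma>) * (norm (\<theta> * \<delta> - \<theta>))\<^sup>2)"
    unfolding envelope_def by (rule INF_lower) simp
  also have "\<dots> \<le> objective l p \<delta> (\<theta> * \<delta>) + ereal (1 / (2 * \<gamma>) * (norm (\<theta> - \<theta> * \<delta>))\<^sup>2)"
    using convex_grad_inequality[OF cvx grad, of "\<theta> * \<delta>"]
    by (simp add: objective_def penalty_Rsub restrict_in_Rsub norm_minus_commute)
  finally show ?thesis .
qed

text \<open>Write \<open>t = \<theta> * \<delta>\<close>. Only competitors \<open>u\<close> supported on the pattern matter, and for these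
  \<open>v = u - t\<close> is orthogonal to \<open>\<theta> - t\<close>, so the proximal term splits by Pythagoras. Bounding \<open>l \<theta>\<close>
  and the penalty at \<open>u\<close> from below by their tangents at \<open>t\<close> leaves the linear form
  \<open>w \<bullet> v\<close>, with \<open>w\<close> the vector whose norm enters the remainder, plus
  \<open>norm v ^ 2 / (2 * \<gamma>)\<close>; completing the square bounds this below by
  \<open>- \<gamma> / 2 * norm w ^ 2\<close>.\<close>

lemma envelope_ge:
  fixes l :: "real ^ 'n \<Rightarrow> real"
  assumes cvx: "convex_on UNIV l" and grad: "GDERIV l (\<theta> * \<delta>) :> grad l (\<theta> * \<delta>)"
    and \<delta>: "\<delta> \<in> Delta" and \<gamma>: "0 < \<gamma>"
    and sub: "is_subgradient (penalty p \<delta>) (\<theta> * \<delta>) (g \<delta> (\<theta> * \<delta>))"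
  shows "objective l p \<delta> (\<theta> * \<delta>)
      + ereal (1 / (2 * \<gamma>) * (norm (\<theta> - \<theta> * \<delta>))\<^sup>2 - remainder l g \<gamma> \<delta> \<theta>)
    \<le> envelope l p \<gamma> \<delta> \<theta>"
  unfolding envelope_def
proof (rule INF_greatest)
  fix u :: "real ^ 'n"
  define t where "t = \<theta> * \<delta>"
  define P where "P x = - (\<Sum>j | \<delta> $ j = 1. ln (p (x $ j)))" for x :: "real ^ 'n"
  have pen: "penalty p \<delta> x = ereal (P x)" if "x \<in> Rsub \<delta>" for x
    using that by (simp add: penalty_Rsub P_def)
  show "objective l p \<delta> (\<theta> * \<delta>)
      + ereal (1 / (2 * \<gamma>) * (norm (\<theta> - \<theta> * \<delta>))\<^sup>2 - remainder l g \<gamma> \<delta> \<theta>)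
    \<le> ereal (l \<theta> + grad l \<theta> \<bullet> (u - \<theta>)) + penalty p \<delta> u + ereal (1 / (2 * \<gamma>) * (norm (u - \<theta>))\<^sup>2)"
  proof (cases "u \<in> Rsub \<delta>")
    case False
    then show ?thesis by (simp add: penalty_def)
  next
    case True
    define v where "v = u - t"
    define w where "w = \<delta> * grad l \<theta> + \<delta> * g \<delta> t"
    \<comment> \<open>As \<open>v\<close> is supported on the pattern, it sees only the components of a vector on the pattern.\<close>
    have v: "v * \<delta> = v"
      using True Delta_cases[OF \<delta>] unfolding vec_eq_iff v_def t_def Rsub_def by force
    have restrict_inner: "x \<bullet> v = (\<delta> * x) \<bullet> v" for x
    proof -
      have "x \<bullet> (v * \<delta>) = (\<delta> * x) \<bullet> v" by (simp add: inner_vec_def mult_ac)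
      then show ?thesis by (simp add: v)
    qed
    have "(\<delta> * (\<theta> - t)) = 0"
      using Delta_cases[OF \<delta>] unfolding vec_eq_iff t_def by force
    then have orth: "(\<theta> - t) \<bullet> v = 0" by (subst restrict_inner) simp
    have "(norm (v - (\<theta> - t)))\<^sup>2 = (norm v)\<^sup>2 + (norm (\<theta> - t))\<^sup>2"
      unfolding power2_norm_eq_inner
      using orth inner_diff_left[of v "\<theta> - t"] inner_diff_right[of _ v "\<theta> - t"]
      by (simp add: inner_commute[of v "\<theta> - t"])
    then have pyth: "(norm (u - \<theta>))\<^sup>2 = (norm v)\<^sup>2 + (norm (\<theta> - t))\<^sup>2"
      by (simp add: v_def)
    have "P t + g \<delta> t \<bullet> v \<le> P u"
      using sub pen[OF True] pen[of t]
      by (auto simp: is_subgradient_def t_def v_def restrict_in_Rsub dest!: spec[of _ u])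
    moreover have "l t + grad l t \<bullet> (\<theta> - t) \<le> l \<theta>"
      using convex_grad_inequality[OF cvx grad, of \<theta>] by (simp add: t_def)
    moreover have "0 \<le> w \<bullet> v + \<gamma> / 2 * (norm w)\<^sup>2 + 1 / (2 * \<gamma>) * (norm v)\<^sup>2"
    proof -
      have "0 \<le> 1 / (2 * \<gamma>) * (norm (\<gamma> *\<^sub>R w + v))\<^sup>2" using \<gamma> by simp
      also have "(norm (\<gamma> *\<^sub>R w + v))\<^sup>2 = \<gamma>\<^sup>2 * (norm w)\<^sup>2 + 2 * \<gamma> * (w \<bullet> v) + (norm v)\<^sup>2"
        unfolding power2_norm_eq_inner
        by (simp add: inner_add_left inner_add_right inner_commute[of v w] power2_eq_square distrib_left)
      also have "1 / (2 * \<gamma>) * \<dots> = w \<bullet> v + \<gamma> / 2 * (norm w)\<^sup>2 + 1 / (2 * \<gamma>) * (norm v)\<^sup>2"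
        using \<gamma> by (simp add: field_simps power2_eq_square)
      finally show ?thesis .
    qed
    moreover have "w \<bullet> v = grad l \<theta> \<bullet> v + g \<delta> t \<bullet> v"
      by (simp add: w_def inner_add_left flip: restrict_inner)
    moreover have "grad l \<theta> \<bullet> (u - \<theta>) = grad l \<theta> \<bullet> v - grad l \<theta> \<bullet> (\<theta> - t)"
      by (simp add: v_def inner_diff_right)
    moreover have "remainder l g \<gamma> \<delta> \<theta>
        = grad l \<theta> \<bullet> (\<theta> - t) - grad l t \<bullet> (\<theta> - t) + \<gamma> / 2 * (norm w)\<^sup>2"
      by (simp add: remainder_def w_def t_def inner_diff_left)
    moreover have "1 / (2 * \<gamma>) * (norm (u - \<theta>))\<^sup>2
        = 1 / (2 * \<gamma>) * (norm v)\<^sup>2 + 1 / (2 * \<gamma>) * (norm (\<theta> - t))\<^sup>2"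
      unfolding pyth by (rule distrib_left)
    ultimately have "l t + P t + (1 / (2 * \<gamma>) * (norm (\<theta> - t))\<^sup>2 - remainder l g \<gamma> \<delta> \<theta>)
        \<le> l \<theta> + grad l \<theta> \<bullet> (u - \<theta>) + P u + 1 / (2 * \<gamma>) * (norm (u - \<theta>))\<^sup>2"
      by linarith
    then show ?thesis
      using pen[OF True] pen[of t] by (simp add: objective_def t_def restrict_in_Rsub)
  qed
qed

text \<open>An infimum of uncountably many functions that are continuous in \<open>\<theta>\<close> (or constantly infinite)
  is upper semicontinuous, which is enough.\<close>

lemma envelope_measurable:
  fixes l :: "real ^ 'n \<Rightarrow> real"
  assumes "continuous_on UNIV l" "continuous_on UNIV (grad l)"
  shows "envelope l p \<gamma> \<delta> \<in> borel_measurable borel"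
proof (rule borel_measurableI_less)
  fix c :: ereal
  define E where "E u \<theta> = ereal (l \<theta> + grad l \<theta> \<bullet> (u - \<theta>)) + penalty p \<delta> u
             + ereal (1 / (2 * \<gamma>) * (norm (u - \<theta>))\<^sup>2)" for u \<theta>
  have "open {\<theta>. E u \<theta> < c}" for u
  proof (cases "u \<in> Rsub \<delta>")
    case True
    define b where "b = - (\<Sum>j | \<delta> $ j = 1. ln (p (u $ j)))"
    have "E u = (\<lambda>\<theta>. ereal (l \<theta> + grad l \<theta> \<bullet> (u - \<theta>) + b + 1 / (2 * \<gamma>) * (norm (u - \<theta>))\<^sup>2))"
      using True by (simp add: E_def penalty_Rsub b_def fun_eq_iff)
    moreover have "continuous_on UNIV \<dots>"
      by (intro continuous_intros assms)
    ultimately show ?thesis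
      by (simp add: open_Collect_less)
  next
    case False
    then have "E u \<theta> = \<infinity>" for \<theta> by (simp add: E_def penalty_def)
    then show ?thesis by simp
  qed
  then have "open (\<Union>u. {\<theta>. E u \<theta> < c})" by blast
  moreover have "{\<theta> \<in> space borel. envelope l p \<gamma> \<delta> \<theta> < c} = (\<Union>u. {\<theta>. E u \<theta> < c})"
    by (auto simp: envelope_def E_def INF_less_iff)
  ultimately show "{\<theta> \<in> space borel. envelope l p \<gamma> \<delta> \<theta> < c} \<in> sets borel" by simp
qed

lemma penalty_measurable:
  fixes \<delta> :: "real ^ 'n"
  assumes [measurable]: "p \<in> borel_measurable borel"
  shows "penalty p \<delta> \<in> borel_measurable borel"
proof -
  have [measurable]: "Measurable.pred borel (\<lambda>\<theta>. \<theta> \<in> Rsub \<delta>)"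
    unfolding Rsub_def by simp
  show ?thesis unfolding penalty_def[abs_def] by measurable
qed

lemma eexp_measurable [measurable]: "eexp \<in> borel_measurable borel"
  unfolding eexp_def[abs_def] by measurable

lemma eexp_mono: "x \<le> y \<Longrightarrow> eexp x \<le> eexp y"
  by (cases x; cases y) (auto simp: eexp_def ennreal_leI)

lemma eexp_ereal [simp]: "eexp (ereal x) = ennreal (exp x)"
  by (simp add: eexp_def)


lemma envelope_antimono:
  assumes "0 < \<gamma>" "\<gamma> \<le> \<gamma>\<^sub>0"
  shows "envelope l p \<gamma>\<^sub>0 \<delta> \<theta> \<le> envelope l p \<gamma> \<delta> \<theta>"
proof -
  have "1 / (2 * \<gamma>\<^sub>0) * a\<^sup>2 \<le> 1 / (2 * \<gamma>) * a\<^sup>2" for a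
    using assms by (intro mult_right_mono frac_le) auto
  then show ?thesis
    unfolding envelope_def by (intro INF_mono') (auto intro!: add_left_mono)
qed

lemma posterior_env_well_defined_antimono:
  assumes prior: "\<And>\<delta>. \<delta> \<in> Delta \<Longrightarrow> 0 \<le> prior \<delta>"
    and \<gamma>: "0 < \<gamma>" "\<gamma> \<le> \<gamma>\<^sub>0"
    and wd: "posterior_env_well_defined l p prior \<gamma>\<^sub>0"
  shows "posterior_env_well_defined l p prior \<gamma>"
proof -
  have "(\<Sum>\<delta>\<in>Delta. ennreal (prior \<delta> * (2 * pi * \<gamma>) powr (real (norm0 \<delta>) / 2))
        * (\<integral>\<^sup>+ \<theta>. eexp (- envelope l p \<gamma> \<delta> \<theta>) \<partial>lborel))
     \<le> (\<Sum>\<delta>\<in>Delta. ennreal (prior \<delta> * (2 * pi * \<gamma>\<^sub>0) powr (real (norm0 \<delta>) / 2))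
        * (\<integral>\<^sup>+ \<theta>. eexp (- envelope l p \<gamma>\<^sub>0 \<delta> \<theta>) \<partial>lborel))"
    using \<gamma> by (intro sum_mono mult_mono nn_integral_mono eexp_mono ennreal_leI mult_left_mono powr_mono2)
      (auto simp: prior envelope_antimono)
  then show ?thesis
    using wd unfolding posterior_env_well_defined_def by (rule order_le_less_trans)
qed

text \<open>The factor \<open>k\<close> converts the power of \<open>2 * pi * \<gamma>\<close> that normalises the noise off the pattern,
  of exponent \<open>- (d - norm0 \<delta>) / 2\<close>, into the exponent \<open>norm0 \<delta> / 2\<close> of the envelope weight; it
  does not depend on the pattern and so disappears on normalisation.\<close>

lemma weights_sandwich:
  fixes l :: "real ^ 'n \<Rightarrow> real"
  assumes cvx: "convex_on UNIV l" and grad: "\<And>x. GDERIV l x :> grad l x"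
    and \<delta>: "\<delta> \<in> Delta" and \<gamma>: "0 < \<gamma>" and a: "0 \<le> a"
    and sub: "is_subgradient (penalty p \<delta>) (\<theta> * \<delta>) (g \<delta> (\<theta> * \<delta>))"
  defines "u \<equiv> ennreal (noise_density \<gamma> \<delta> \<theta>) * (ennreal a * eexp (- objective l p \<delta> (\<theta> * \<delta>)))"
    and "v \<equiv> ennreal (a * (2 * pi * \<gamma>) powr (real (norm0 \<delta>) / 2)) * eexp (- envelope l p \<gamma> \<delta> \<theta>)"
    and "k \<equiv> (2 * pi * \<gamma>) powr (real CARD('n) / 2)"
  shows "ennreal k * u \<le> v" "v \<le> ennreal k * (u * ennreal (exp (remainder l g \<gamma> \<delta> \<theta>)))"
    "u \<noteq> \<infinity>" "0 < a \<Longrightarrow> 0 < u"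
proof -
  define q where "q = 1 / (2 * \<gamma>) * (norm (\<theta> - \<theta> * \<delta>))\<^sup>2"
  define r where "r = remainder l g \<gamma> \<delta> \<theta>"
  have k: "0 < k" using \<gamma> by (simp add: k_def)
  obtain h where h: "objective l p \<delta> (\<theta> * \<delta>) = ereal h"
    by (simp add: objective_def penalty_Rsub restrict_in_Rsub)
  have le: "envelope l p \<gamma> \<delta> \<theta> \<le> ereal (h + q)"
    using envelope_le[OF cvx grad, of p \<gamma> \<delta> \<theta>] by (simp add: h q_def)
  have ge: "ereal (h + q - r) \<le> envelope l p \<gamma> \<delta> \<theta>"
    using envelope_ge[where \<theta> = \<theta> and p = p and g = g, OF cvx grad \<delta> \<gamma> sub]
    by (simp add: h q_def r_def add_diff_eq)
  with le obtain e where e: "envelope l p \<gamma> \<delta> \<theta> = ereal e"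
    by (cases "envelope l p \<gamma> \<delta> \<theta>") auto
  define c where "c = a * (2 * pi * \<gamma>) powr (real (norm0 \<delta>) / 2)"
  have c: "0 \<le> c" using a by (simp add: c_def)
  have k_noise: "k * noise_density \<gamma> \<delta> \<theta> = (2 * pi * \<gamma>) powr (real (norm0 \<delta>) / 2) * exp (- q)"
    using \<gamma> by (simp add: noise_density_eq[OF \<delta> \<gamma>] k_def q_def powr_divide diff_divide_distrib powr_diff)
  have "k * (noise_density \<gamma> \<delta> \<theta> * (a * exp (- h))) = (k * noise_density \<gamma> \<delta> \<theta>) * (a * exp (- h))"
    by (simp only: mult.assoc)
  also have "\<dots> = c * (exp (- q) * exp (- h))"
    unfolding k_noise c_def by (simp only: mult_ac)
  also have "exp (- q) * exp (- h) = exp (- (h + q))"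
    by (simp add: exp_add[symmetric])
  finally have ku: "k * (noise_density \<gamma> \<delta> \<theta> * (a * exp (- h))) = c * exp (- (h + q))" .
  have u_eq: "u = ennreal (noise_density \<gamma> \<delta> \<theta> * (a * exp (- h)))"
    using a noise_density_nonneg[of \<gamma> \<delta> \<theta>] by (simp add: u_def h ennreal_mult)
  have ku_eq: "ennreal k * u = ennreal (c * exp (- (h + q)))"
    unfolding u_eq ku[symmetric] using k by (simp add: ennreal_mult')
  have v_eq: "v = ennreal (c * exp (- e))"
    using c by (simp add: v_def e c_def ennreal_mult)
  show "ennreal k * u \<le> v"
    unfolding ku_eq v_eq using le c by (intro ennreal_leI mult_left_mono) (auto simp: e)
  have "v \<le> ennreal (c * exp (- (h + q)) * exp r)"
    unfolding v_eq mult.assoc exp_add[symmetric]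
    using ge c by (intro ennreal_leI mult_left_mono) (auto simp: e)
  also have "\<dots> = ennreal k * u * ennreal (exp r)"
    unfolding ku_eq using c by (simp add: ennreal_mult)
  finally show "v \<le> ennreal k * (u * ennreal (exp (remainder l g \<gamma> \<delta> \<theta>)))"
    by (simp add: r_def mult.assoc)
  show "u \<noteq> \<infinity>" by (simp add: u_eq)
  show "0 < u" if "0 < a" using that noise_density_pos[OF \<gamma>, of \<delta> \<theta>] by (simp add: u_eq)
qed

section \<open>Comparison of probability measures\<close>

lemma sets_normalize [simp]: "sets (normalize_measure M) = sets M"
  by (simp add: normalize_measure_def)

lemma space_normalize [simp]: "space (normalize_measure M) = space M"
  by (simp add: normalize_measure_def space_scale_measure)

lemma measurable_normalize [simp]: "normalize_measure M \<rightarrow>\<^sub>M N = M \<rightarrow>\<^sub>M N"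
  by (simp add: measurable_def)

lemma nn_integral_normalize:
  "F \<in> borel_measurable M \<Longrightarrow>
    (\<integral>\<^sup>+ x. F x \<partial>normalize_measure M) = inverse (emeasure M (space M)) * (\<integral>\<^sup>+ x. F x \<partial>M)"
  by (simp add: normalize_measure_def nn_integral_scale_measure)

lemma prob_space_normalize:
  assumes "emeasure M (space M) \<noteq> 0" "emeasure M (space M) \<noteq> \<infinity>"
  shows "prob_space (normalize_measure M)"
proof (rule prob_spaceI)
  show "emeasure (normalize_measure M) (space (normalize_measure M)) = 1"
    using assms unfolding space_normalize
    by (simp add: normalize_measure_def ennreal_divide_self less_top zero_less_iff_neq_zero mult.commute flip: divide_ennreal_def)
qed

lemma normalize_distr:
  assumes T: "T \<in> M \<rightarrow>\<^sub>M N"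
  shows "normalize_measure (distr M N T) = distr (normalize_measure M) N T"
proof (rule measure_eqI)
  fix A assume "A \<in> sets (normalize_measure (distr M N T))"
  then have A: "A \<in> sets N" by simp
  have T': "T \<in> normalize_measure M \<rightarrow>\<^sub>M N" using T by simp
  have "T -` space N \<inter> space M = space M"
    using measurable_space[OF T] by auto
  then show "emeasure (normalize_measure (distr M N T)) A = emeasure (distr (normalize_measure M) N T) A"
    using emeasure_distr[OF T' A] emeasure_distr[OF T A] emeasure_distr[OF T sets.top]
    by (simp add: normalize_measure_def space_scale_measure)
qed simp

text \<open>Apply the domination hypothesis to the nonnegative functions \<open>1 + f\<close> and \<open>1 - f\<close>. Their
  \<open>M\<close>-expectations are at most \<open>2\<close>, so each \<open>N\<close>-expectation falls short by at most
  \<open>2 * (1 - t)\<close>.\<close>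

lemma expectation_diff_le_of_minorant:
  fixes f :: "'a \<Rightarrow> real"
  assumes "prob_space M" "prob_space N" and sets: "sets N = sets M"
    and f: "f \<in> borel_measurable M" and bound: "\<And>x. x \<in> space M \<Longrightarrow> \<bar>f x\<bar> \<le> 1"
    and t: "0 \<le> t"
    and minor: "\<And>F. F \<in> borel_measurable M \<Longrightarrow> ennreal t * (\<integral>\<^sup>+ x. F x \<partial>M) \<le> (\<integral>\<^sup>+ x. F x \<partial>N)"
  shows "\<bar>(\<integral> x. f x \<partial>N) - (\<integral> x. f x \<partial>M)\<bar> \<le> 2 * (1 - t)"
proof -
  interpret M: prob_space M by fact
  interpret N: prob_space N by fact
  have space: "space N = space M" using sets by (rule sets_eq_imp_space_eq)
  have fN: "f \<in> borel_measurable N" using f sets by (simp cong: measurable_cong_sets)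
  have t1: "t \<le> 1"
    using minor[of "\<lambda>_. 1"] t by (simp add: M.emeasure_space_1 N.emeasure_space_1)
  \<comment> \<open>\<open>s\<close> is the sign in \<open>1 + f\<close> or \<open>1 - f\<close>.\<close>
  have one_sided: "t * (1 + s * (\<integral> x. f x \<partial>M)) \<le> 1 + s * (\<integral> x. f x \<partial>N)" if s: "\<bar>s\<bar> = 1" for s :: real
  proof -
    have nonneg: "0 \<le> 1 + s * f x" if "x \<in> space M" for x
      using bound[OF that] s by (auto simp: abs_if split: if_splits)
    have iM: "integrable M f" using bound f by (intro M.integrable_const_bound[of _ 1]) auto
    have iN: "integrable N f" using bound fN space by (intro N.integrable_const_bound[of _ 1]) auto
    have "ennreal t * (\<integral>\<^sup>+ x. ennreal (1 + s * f x) \<partial>M) \<le> (\<integral>\<^sup>+ x. ennreal (1 + s * f x) \<partial>N)"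
      using f by (intro minor) simp
    moreover have "(\<integral>\<^sup>+ x. ennreal (1 + s * f x) \<partial>M) = ennreal (1 + s * (\<integral> x. f x \<partial>M))"
    proof -
      have "(\<integral>\<^sup>+ x. ennreal (1 + s * f x) \<partial>M) = ennreal (\<integral> x. 1 + s * f x \<partial>M)"
        using iM nonneg by (intro nn_integral_eq_integral) auto
      then show ?thesis using iM by (simp add: M.prob_space)
    qed
    moreover have "(\<integral>\<^sup>+ x. ennreal (1 + s * f x) \<partial>N) = ennreal (1 + s * (\<integral> x. f x \<partial>N))"
    proof -
      have "(\<integral>\<^sup>+ x. ennreal (1 + s * f x) \<partial>N) = ennreal (\<integral> x. 1 + s * f x \<partial>N)"
        using iN nonneg by (intro nn_integral_eq_integral) (auto simp: space)
      then show ?thesis using iN N.prob_space by simp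
    qed
    moreover have "0 \<le> (\<integral> x. 1 + s * f x \<partial>N)"
      using nonneg by (intro integral_nonneg_AE) (auto simp: space)
    then have "0 \<le> 1 + s * (\<integral> x. f x \<partial>N)" using iN N.prob_space by simp
    ultimately have "ennreal (t * (1 + s * (\<integral> x. f x \<partial>M))) \<le> ennreal (1 + s * (\<integral> x. f x \<partial>N))"
      using t by (simp add: ennreal_mult')
    then show ?thesis
      using \<open>0 \<le> 1 + s * (\<integral> x. f x \<partial>N)\<close> by (simp add: ennreal_le_iff)
  qed
  have "\<bar>\<integral> x. f x \<partial>M\<bar> \<le> (\<integral> x. 1 \<partial>M)"
    using bound f by (intro order_trans[OF integral_abs_bound] integral_mono)
      (auto intro!: M.integrable_const_bound[of _ 1])
  then have "\<bar>\<integral> x. f x \<partial>M\<bar> \<le> 1" by (simp add: M.prob_space)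
  then have "(1 - t) * (1 + (\<integral> x. f x \<partial>M)) \<le> (1 - t) * 2" "(1 - t) * (1 - (\<integral> x. f x \<partial>M)) \<le> (1 - t) * 2"
    using t1 by (intro mult_left_mono; linarith)+
  then show ?thesis
    using one_sided[of 1] one_sided[of "-1"] by (simp add: algebra_simps abs_le_iff)
qed

lemma emeasure_density_whole:
  assumes "w \<in> borel_measurable M"
  shows "emeasure (density M w) (space (density M w)) = (\<integral>\<^sup>+ x. w x \<partial>M)"
  using assms by (simp add: emeasure_density cong: nn_integral_cong)

text \<open>The constant \<open>t\<close> is \<open>k\<close> times the ratio of the two total masses; the lower bound \<open>k * u \<le> v\<close>
  becomes the domination, and integrating the upper bound gives \<open>1 \<le> t * (\<integral>\<^sup>+ x. R x \<partial>M)\<close> for the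
  normalised first measure \<open>M\<close>. In the application \<open>R\<close> contains an arbitrary selection of
  subgradients and may fail to be measurable, so its integral is bounded below by that of the
  measurable ratio \<open>v / (k * u)\<close>, which lies below \<open>R\<close> and has the right integral.\<close>

lemma density_sandwich_minorant:
  fixes u v R :: "'a \<Rightarrow> ennreal"
  assumes u: "u \<in> borel_measurable B" and v: "v \<in> borel_measurable B"
    and k: "0 < k"
    and u_finite: "\<And>x. x \<in> space B \<Longrightarrow> u x \<noteq> \<infinity>"
    and lower: "\<And>x. x \<in> space B \<Longrightarrow> ennreal k * u x \<le> v x"
    and upper: "\<And>x. x \<in> space B \<Longrightarrow> v x \<le> ennreal k * (u x * R x)"
    and Zu: "(\<integral>\<^sup>+ x. u x \<partial>B) \<noteq> 0" and Zv: "(\<integral>\<^sup>+ x. v x \<partial>B) \<noteq> \<infinity>"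
  obtains t where "0 \<le> t" "1 \<le> ennreal t * (\<integral>\<^sup>+ x. R x \<partial>normalize_measure (density B u))"
    "\<And>F. F \<in> borel_measurable B \<Longrightarrow>
      ennreal t * (\<integral>\<^sup>+ x. F x \<partial>normalize_measure (density B u)) \<le> (\<integral>\<^sup>+ x. F x \<partial>normalize_measure (density B v))"
proof -
  have normalized: "(\<integral>\<^sup>+ x. F x \<partial>normalize_measure (density B w)) = inverse (\<integral>\<^sup>+ x. w x \<partial>B) * (\<integral>\<^sup>+ x. w x * F x \<partial>B)"
    if "w \<in> borel_measurable B" "F \<in> borel_measurable B" for w F
    using that emeasure_density_whole[OF that(1)] by (simp add: nn_integral_normalize nn_integral_density)
  have "ennreal k * (\<integral>\<^sup>+ x. u x \<partial>B) \<le> (\<integral>\<^sup>+ x. v x \<partial>B)"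
    using u lower by (subst nn_integral_cmult[symmetric]) (auto intro!: nn_integral_mono)
  then have kZ: "ennreal k * (\<integral>\<^sup>+ x. u x \<partial>B) \<noteq> \<infinity>" using Zv by (auto simp: top_unique)
  then have "(\<integral>\<^sup>+ x. u x \<partial>B) \<noteq> \<infinity>" using k by (auto simp: ennreal_mult_eq_top_iff)
  then obtain a where a: "(\<integral>\<^sup>+ x. u x \<partial>B) = ennreal a" "0 < a"
    using Zu by (cases "\<integral>\<^sup>+ x. u x \<partial>B") (auto simp: less_le)
  obtain b where b: "(\<integral>\<^sup>+ x. v x \<partial>B) = ennreal b" "0 \<le> b"
    using Zv by (cases "\<integral>\<^sup>+ x. v x \<partial>B") auto
  have "ennreal (k * a) \<le> ennreal b"
    using \<open>ennreal k * (\<integral>\<^sup>+ x. u x \<partial>B) \<le> (\<integral>\<^sup>+ x. v x \<partial>B)\<close> a b k by (simp add: ennreal_mult)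
  then have "0 < b" using k a b by (metis ennreal_le_iff mult_pos_pos order_less_le_trans)
  define t where "t = k * a / b"
  have t: "0 < t" using k a \<open>0 < b\<close> by (simp add: t_def)
  show ?thesis
  proof (rule that)
    show "0 \<le> t" using t by simp
    show "ennreal t * (\<integral>\<^sup>+ x. F x \<partial>normalize_measure (density B u)) \<le> (\<integral>\<^sup>+ x. F x \<partial>normalize_measure (density B v))"
      if F: "F \<in> borel_measurable B" for F
    proof -
      have "ennreal t * (\<integral>\<^sup>+ x. F x \<partial>normalize_measure (density B u))
          = (ennreal t * inverse (ennreal a)) * (\<integral>\<^sup>+ x. u x * F x \<partial>B)"
        using normalized[OF u F] a by (simp add: mult.assoc)
      also have "ennreal t * inverse (ennreal a) = inverse (ennreal b) * ennreal k"
        using a \<open>0 < b\<close> k t by (simp add: t_def inverse_ennreal field_simps flip: ennreal_mult)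
      also have "\<dots> * (\<integral>\<^sup>+ x. u x * F x \<partial>B) = inverse (ennreal b) * (\<integral>\<^sup>+ x. ennreal k * (u x * F x) \<partial>B)"
        using u F by (simp add: nn_integral_cmult mult.assoc)
      also have "\<dots> \<le> inverse (ennreal b) * (\<integral>\<^sup>+ x. v x * F x \<partial>B)"
        using lower by (intro mult_left_mono nn_integral_mono) (auto simp: mult_right_mono simp flip: mult.assoc)
      finally show ?thesis using normalized[OF v F] b by simp
    qed
    define \<rho> where "\<rho> x = v x / (ennreal k * u x)" for x
    have \<rho>_meas: "\<rho> \<in> borel_measurable B" unfolding \<rho>_def using u v by simp
    have \<rho>: "ennreal k * (u x * \<rho> x) = v x" "\<rho> x \<le> R x" if x: "x \<in> space B" for x
    proof -
      have fin: "ennreal k * u x \<noteq> \<infinity>" using u_finite[OF x] by (simp add: ennreal_mult_eq_top_iff)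
      \<comment> \<open>Where \<open>u\<close> vanishes so does \<open>v\<close>, and \<open>0 / 0 = 0\<close>.\<close>
      have zero: "v x = 0" if "ennreal k * u x = 0" using upper[OF x] that
        by (metis mult.assoc mult_zero_left le_zero_eq)
      have "ennreal k * u x * \<rho> x = v x"
      proof (cases "ennreal k * u x = 0")
        case False
        then have "v x * (ennreal k * u x) / (ennreal k * u x) = v x"
          using fin by (intro ennreal_mult_divide_eq) auto
        then show ?thesis by (simp only: \<rho>_def ennreal_times_divide mult.commute)
      qed (simp add: zero)
      then show "ennreal k * (u x * \<rho> x) = v x" by (simp only: mult.assoc)
      show "\<rho> x \<le> R x"
      proof (cases "ennreal k * u x = 0")
        case True
        then show ?thesis using zero by (simp add: \<rho>_def)
      next
        case False
        then have "\<rho> x \<le> (R x * (ennreal k * u x)) / (ennreal k * u x)"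
          unfolding \<rho>_def using upper[OF x] by (intro divide_right_mono_ennreal) (simp add: mult_ac)
        also have "\<dots> = R x" using False fin by (simp add: ennreal_mult_divide_eq)
        finally show ?thesis .
      qed
    qed
    have "ennreal k * (\<integral>\<^sup>+ x. u x * \<rho> x \<partial>B) = ennreal b"
      using u \<rho>_meas \<rho>(1) b by (subst nn_integral_cmult[symmetric]) (auto cong: nn_integral_cong)
    have "1 = ennreal t * inverse (ennreal a) * inverse (ennreal k) * ennreal b"
      using a \<open>0 < b\<close> k t by (simp add: t_def inverse_ennreal field_simps flip: ennreal_mult)
    also have "\<dots> = ennreal t * (\<integral>\<^sup>+ x. \<rho> x \<partial>normalize_measure (density B u)) * (inverse (ennreal k) * ennreal k)"
      using normalized[OF u \<rho>_meas] a by (simp add: mult_ac flip: \<open>ennreal k * (\<integral>\<^sup>+ x. u x * \<rho> x \<partial>B) = ennreal b\<close>)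
    also have "inverse (ennreal k) * ennreal k = 1"
      using k by (simp add: inverse_ennreal flip: ennreal_mult)
    also have "ennreal t * (\<integral>\<^sup>+ x. \<rho> x \<partial>normalize_measure (density B u)) * 1
        \<le> ennreal t * (\<integral>\<^sup>+ x. R x \<partial>normalize_measure (density B u))"
      using \<rho>(2) by (auto intro!: mult_left_mono nn_integral_mono)
    finally show "1 \<le> ennreal t * (\<integral>\<^sup>+ x. R x \<partial>normalize_measure (density B u))" .
  qed
qed

lemma exp_neg_elog_le:
  assumes "0 \<le> t" "1 \<le> ennreal t * X"
  shows "enn2real (eexp (- elog X)) \<le> t"
proof (cases X)
  case (real x)
  show ?thesis
  proof (cases "x = 0")
    case True
    then show ?thesis using assms real by simp
  next
    case False
    then have "0 < x" using real by simp
    moreover have "1 \<le> t * x" using assms real by (simp flip: ennreal_mult)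
    ultimately show ?thesis
      using real by (simp add: elog_def exp_minus field_simps)
  qed
next
  case top
  then show ?thesis using assms by (simp add: elog_def eexp_def)
qed

text \<open>The mean displacement is at most the root of its second moment, here through
  \<open>D \<le> D ^ 2 / (2 * s) + s / 2\<close>, with equality at \<open>D = s\<close>.\<close>

lemma expectation_displacement_le:
  fixes f :: "'a \<Rightarrow> real" and D :: "'a \<Rightarrow> real"
  assumes "prob_space M" and T: "T \<in> M \<rightarrow>\<^sub>M M"
    and f: "f \<in> borel_measurable M" and bound: "\<And>x. x \<in> space M \<Longrightarrow> \<bar>f x\<bar> \<le> 1"
    and D: "\<And>x. x \<in> space M \<Longrightarrow> \<bar>f x - f (T x)\<bar> \<le> D x"
    and D_meas: "D \<in> borel_measurable M"
    and s: "0 < s" and moment: "(\<integral>\<^sup>+ x. ennreal ((D x)\<^sup>2) \<partial>M) \<le> ennreal (s\<^sup>2)"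
  shows "\<bar>(\<integral> x. f x \<partial>M) - (\<integral> x. f (T x) \<partial>M)\<bar> \<le> s"
proof -
  interpret prob_space M by fact
  have fT: "(\<lambda>x. f (T x)) \<in> borel_measurable M" using T f by (rule measurable_compose)
  have int: "integrable M f" "integrable M (\<lambda>x. f (T x))"
    using bound f fT measurable_space[OF T] by (auto intro!: integrable_const_bound[of _ 1])
  have "ennreal \<bar>(\<integral> x. f x \<partial>M) - (\<integral> x. f (T x) \<partial>M)\<bar> \<le> (\<integral>\<^sup>+ x. ennreal \<bar>f x - f (T x)\<bar> \<partial>M)"
    using integral_norm_bound_ennreal[of M "\<lambda>x. f x - f (T x)"] int by simp
  also have "\<dots> \<le> (\<integral>\<^sup>+ x. ennreal (1 / (2 * s)) * ennreal ((D x)\<^sup>2) + ennreal (s / 2) \<partial>M)"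
  proof (rule nn_integral_mono)
    fix x assume "x \<in> space M"
    have "0 \<le> (D x - s)\<^sup>2 / (2 * s)" using s by simp
    also have "\<dots> = 1 / (2 * s) * (D x)\<^sup>2 + s / 2 - D x"
      using s by (simp add: field_simps power2_eq_square)
    finally have "\<bar>f x - f (T x)\<bar> \<le> 1 / (2 * s) * (D x)\<^sup>2 + s / 2"
      using D[OF \<open>x \<in> space M\<close>] by linarith
    then show "ennreal \<bar>f x - f (T x)\<bar> \<le> ennreal (1 / (2 * s)) * ennreal ((D x)\<^sup>2) + ennreal (s / 2)"
      using s by (simp flip: ennreal_mult ennreal_plus)
  qed
  also have "\<dots> = ennreal (1 / (2 * s)) * (\<integral>\<^sup>+ x. ennreal ((D x)\<^sup>2) \<partial>M) + ennreal (s / 2)"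
    using D_meas by (simp add: nn_integral_add nn_integral_cmult emeasure_space_1)
  also have "\<dots> \<le> ennreal (1 / (2 * s)) * ennreal (s\<^sup>2) + ennreal (s / 2)"
    using moment by (intro add_mono mult_left_mono) auto
  also have "\<dots> = ennreal s"
    using s by (simp add: power2_eq_square flip: ennreal_mult ennreal_plus)
  finally show ?thesis using s by simp
qed

text \<open>The side conditions on \<open>dst\<close> exclude division by zero in the Lipschitz quotient.\<close>

lemma bounded_lipschitz_testD:
  assumes "sup_norm_on S f + lipschitz_const dst S f \<le> 1"
  shows "x \<in> S \<Longrightarrow> \<bar>f x\<bar> \<le> 1"
    and "x \<in> S \<Longrightarrow> y \<in> S \<Longrightarrow> 0 \<le> dst x y \<Longrightarrow> (x \<noteq> y \<Longrightarrow> dst x y \<noteq> 0) \<Longrightarrow> \<bar>f x - f y\<bar> \<le> dst x y"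
proof -
  show "\<bar>f x\<bar> \<le> 1" if "x \<in> S"
  proof -
    have "ennreal \<bar>f x\<bar> \<le> sup_norm_on S f"
      unfolding sup_norm_on_def using that by (intro SUP_upper)
    also have "\<dots> \<le> sup_norm_on S f + lipschitz_const dst S f" by simp
    also have "\<dots> \<le> 1" by fact
    finally show ?thesis by simp
  qed
  show "\<bar>f x - f y\<bar> \<le> dst x y" if "x \<in> S" "y \<in> S" "0 \<le> dst x y" "x \<noteq> y \<Longrightarrow> dst x y \<noteq> 0"
  proof (cases "x = y")
    case False
    have "ennreal (\<bar>f x - f y\<bar> / dst x y) \<le> lipschitz_const dst S f"
      unfolding lipschitz_const_def using that False by (intro SUP_upper2[of "(x, y)"]) auto
    also have "\<dots> \<le> sup_norm_on S f + lipschitz_const dst S f" by simp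
    also have "\<dots> \<le> 1" by fact
    finally have "\<bar>f x - f y\<bar> / dst x y \<le> 1" by simp
    then show ?thesis using that False by (simp add: divide_le_eq)
  qed (use that in simp)
qed


section \<open>Smearing a joint measure by Gaussian noise\<close>

abbreviation project :: "(real ^ 'n) \<times> (real ^ 'n) \<Rightarrow> (real ^ 'n) \<times> (real ^ 'n)" where
  "project \<equiv> \<lambda>(\<delta>, \<theta>). (\<delta>, \<theta> * \<delta>)"

lemma project_measurable: "project \<in> pattern_lborel \<rightarrow>\<^sub>M pattern_space"
  by (rule measurable_patternI) auto

lemma joint_measure_cong:
  assumes "\<And>\<delta> \<theta>. \<delta> \<in> Delta \<Longrightarrow> w \<delta> \<theta> = w' \<delta> \<theta>"
  shows "joint_measure m w = joint_measure m w'"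
  unfolding joint_measure_def using assms by (simp cong: sum.cong)

abbreviation smeared ::
  "real \<Rightarrow> (real ^ 'n \<Rightarrow> real ^ 'n \<Rightarrow> ennreal) \<Rightarrow> real ^ 'n \<Rightarrow> real ^ 'n \<Rightarrow> ennreal" where
  "smeared \<gamma> W \<equiv> \<lambda>\<delta> \<theta>. ennreal (noise_density \<gamma> \<delta> \<theta>) * W \<delta> (\<theta> * \<delta>)"

lemma smeared_measurable:
  assumes [measurable]: "W \<delta> \<in> borel_measurable borel"
  shows "smeared \<gamma> W \<delta> \<in> borel_measurable borel"
  by measurable

text \<open>The exact coupling: forgetting the noise recovers the joint measure over \<^const>\<open>mu\<close>.\<close>

lemma joint_measure_mu_eq_distr:
  assumes W: "\<And>\<delta>. \<delta> \<in> Delta \<Longrightarrow> W \<delta> \<in> borel_measurable borel" and \<gamma>: "0 < \<gamma>"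
  shows "joint_measure mu W = distr (joint_measure (\<lambda>_. lborel) (smeared \<gamma> W)) pattern_space project"
    (is "_ = distr ?J _ _")
proof (rule joint_measure_eqI)
  fix A assume "A \<in> sets (distr ?J pattern_space project)"
  then have A: "A \<in> sets pattern_space" by simp
  have J: "?J = density pattern_lborel (\<lambda>(\<delta>, \<theta>). smeared \<gamma> W \<delta> \<theta>)"
    by (intro joint_measure_lborel smeared_measurable W)
  have S: "(\<lambda>(\<delta>, \<theta>). smeared \<gamma> W \<delta> \<theta>) \<in> borel_measurable pattern_lborel"
    by (rule measurable_patternI) (simp add: smeared_measurable W)
  define A' where "A' = project -` A \<inter> space pattern_lborel"
  have A': "A' \<in> sets pattern_lborel"
    unfolding A'_def using project_measurable A by (rule measurable_sets)
  have "emeasure (distr ?J pattern_space project) A = emeasure ?J A'"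
    unfolding J using project_measurable A by (subst emeasure_distr) (auto simp: A'_def)
  also have "\<dots> = (\<Sum>\<delta>\<in>Delta. \<integral>\<^sup>+ \<theta>. smeared \<gamma> W \<delta> \<theta> * indicator A' (\<delta>, \<theta>) \<partial>lborel)"
    unfolding J using S A' by (subst emeasure_density) (auto simp: nn_integral_pattern)
  also have "\<dots> = (\<Sum>\<delta>\<in>Delta. \<integral>\<^sup>+ \<theta>. W \<delta> \<theta> * indicator A (\<delta>, \<theta>) \<partial>mu \<delta>)"
  proof (rule sum.cong[OF refl])
    fix \<delta> :: "real ^ 'a" assume \<delta>: "\<delta> \<in> Delta"
    have "(\<lambda>x. indicator A x :: ennreal) \<in> borel_measurable pattern_lborel" using A by simp
    then have "(\<lambda>\<theta>. indicator A (\<delta>, \<theta>) :: ennreal) \<in> borel_measurable borel"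
      using \<delta> by (rule measurable_patternD)
    then have "(\<integral>\<^sup>+ \<theta>. W \<delta> \<theta> * indicator A (\<delta>, \<theta>) \<partial>mu \<delta>)
        = (\<integral>\<^sup>+ \<theta>. ennreal (noise_density \<gamma> \<delta> \<theta>) * (W \<delta> (\<theta> * \<delta>) * indicator A (\<delta>, \<theta> * \<delta>)) \<partial>lborel)"
      using W[OF \<delta>] by (intro nn_integral_mu \<delta> \<gamma>) simp
    also have "\<dots> = (\<integral>\<^sup>+ \<theta>. smeared \<gamma> W \<delta> \<theta> * indicator A' (\<delta>, \<theta>) \<partial>lborel)"
      using \<delta> by (intro nn_integral_cong) (auto simp: A'_def indicator_def)
    finally show "(\<integral>\<^sup>+ \<theta>. smeared \<gamma> W \<delta> \<theta> * indicator A' (\<delta>, \<theta>) \<partial>lborel)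
        = (\<integral>\<^sup>+ \<theta>. W \<delta> \<theta> * indicator A (\<delta>, \<theta>) \<partial>mu \<delta>)" ..
  qed
  finally show "emeasure (distr ?J pattern_space project) A
      = (\<Sum>\<delta>\<in>Delta. \<integral>\<^sup>+ \<theta>. W \<delta> \<theta> * indicator A (\<delta>, \<theta>) \<partial>mu \<delta>)" .
qed simp

lemma displacement_measurable:
  "(\<lambda>(\<delta>, \<theta>). norm (\<theta> - \<theta> * \<delta>)) \<in> borel_measurable pattern_lborel"
  by (rule measurable_patternI) simp

lemma smeared_second_moment:
  assumes W: "\<And>\<delta>. \<delta> \<in> Delta \<Longrightarrow> W \<delta> \<in> borel_measurable borel" and \<gamma>: "0 < \<gamma>"
  defines "J \<equiv> joint_measure (\<lambda>_. lborel) (smeared \<gamma> W) :: ((real ^ 'n) \<times> (real ^ 'n)) measure"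
  shows "(\<integral>\<^sup>+ x. ennreal ((case x of (\<delta>, \<theta>) \<Rightarrow> norm (\<theta> - \<theta> * \<delta>))\<^sup>2) \<partial>J)
    \<le> ennreal (\<gamma> * real CARD('n)) * emeasure J (space J)"
proof -
  have J: "J = density pattern_lborel (\<lambda>(\<delta>, \<theta>). smeared \<gamma> W \<delta> \<theta>)"
    unfolding J_def by (intro joint_measure_lborel smeared_measurable W)
  have S: "(\<lambda>(\<delta>, \<theta>). smeared \<gamma> W \<delta> \<theta>) \<in> borel_measurable pattern_lborel"
    by (rule measurable_patternI) (simp add: smeared_measurable W)
  have sq: "(\<lambda>x. ennreal ((case x of (\<delta>, \<theta>) \<Rightarrow> norm (\<theta> - \<theta> * \<delta>))\<^sup>2)) \<in> borel_measurable pattern_lborel"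
    by (rule measurable_patternI) simp
  have "(\<integral>\<^sup>+ x. ennreal ((case x of (\<delta>, \<theta>) \<Rightarrow> norm (\<theta> - \<theta> * \<delta>))\<^sup>2) \<partial>J)
      = (\<Sum>\<delta>\<in>Delta. \<integral>\<^sup>+ \<theta>. smeared \<gamma> W \<delta> \<theta> * ennreal ((norm (\<theta> - \<theta> * \<delta>))\<^sup>2) \<partial>lborel)"
    unfolding J using S sq
    by (subst nn_integral_density) (auto simp: nn_integral_pattern)
  also have "\<dots> = (\<Sum>\<delta>\<in>Delta. ennreal (\<gamma> * (real CARD('n) - real (norm0 \<delta>))) * (\<integral>\<^sup>+ \<theta>. W \<delta> \<theta> \<partial>mu \<delta>))"
    using nn_integral_mu_square_norm[OF _ \<gamma> W] by (intro sum.cong) (auto simp: mult.commute)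
  also have "\<dots> \<le> (\<Sum>\<delta>\<in>Delta. ennreal (\<gamma> * real CARD('n)) * (\<integral>\<^sup>+ \<theta>. W \<delta> \<theta> \<partial>mu \<delta>))"
    using \<gamma> by (intro sum_mono mult_right_mono ennreal_leI) auto
  also have "\<dots> = ennreal (\<gamma> * real CARD('n)) * (\<Sum>\<delta>\<in>Delta. \<integral>\<^sup>+ \<theta>. smeared \<gamma> W \<delta> \<theta> \<partial>lborel)"
    using nn_integral_mu[OF _ \<gamma> W] by (simp add: sum_distrib_left)
  also have "(\<Sum>\<delta>\<in>Delta. \<integral>\<^sup>+ \<theta>. smeared \<gamma> W \<delta> \<theta> \<partial>lborel) = emeasure J (space J)"
    unfolding J using emeasure_density_whole[OF S] nn_integral_pattern[OF S] by simp
  finally show ?thesis .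
qed

section \<open>The distance between the posteriors\<close>

theorem theorem6:
  fixes f :: "real ^ 'n \<Rightarrow> 'z \<Rightarrow> real" and z :: 'z
    and prior :: "real ^ 'n \<Rightarrow> real" and p :: "real \<Rightarrow> real"
    and g :: "real ^ 'n \<Rightarrow> real ^ 'n \<Rightarrow> real ^ 'n"
    and \<gamma>\<^sub>0 \<gamma> :: real
  assumes prior_nonneg: "\<And>\<delta>. \<delta> \<in> Delta \<Longrightarrow> 0 \<le> prior \<delta>"
    and prior_sum: "(\<Sum>\<delta>\<in>Delta. prior \<delta>) = 1"
    and p_measurable: "p \<in> borel_measurable borel"
    and p_pos: "\<And>x. 0 < p x"
    and p_density: "(\<integral>\<^sup>+ x. ennreal (p x) \<partial>lborel) = 1"
    and l_finite: "\<And>\<theta>. 0 < f \<theta> z"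
    and l_convex: "convex_on UNIV (neg_loglik f z)"
    and l_C2: "twice_continuously_differentiable (neg_loglik f z)"
    and P_convex: "\<And>\<delta> :: real ^ 'n. \<delta> \<in> Delta \<Longrightarrow> ereal_convex (penalty p \<delta>)"
    and P_lsc: "\<And>\<delta> :: real ^ 'n. \<delta> \<in> Delta \<Longrightarrow> lower_semicontinuous (penalty p \<delta>)"
    and P_proper: "\<And>\<delta> :: real ^ 'n. \<delta> \<in> Delta \<Longrightarrow> \<exists>\<theta>. penalty p \<delta> \<theta> \<noteq> \<infinity>"
    and P_subgradient: "\<And>\<delta> \<theta>. \<delta> \<in> Delta \<Longrightarrow> \<theta> \<in> Rsub \<delta> \<Longrightarrow>
          is_subgradient (penalty p \<delta>) \<theta> (g \<delta> \<theta>)"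
    and gamma0_pos: "0 < \<gamma>\<^sub>0"
    and gamma0_wd: "posterior_env_well_defined (neg_loglik f z) p prior \<gamma>\<^sub>0"
    and gamma: "\<gamma> \<in> {0<..\<gamma>\<^sub>0}"
  shows "posterior_env_well_defined (neg_loglik f z) p prior \<gamma> \<and>
         bounded_lipschitz_dist pair_dist
             (posterior_env (neg_loglik f z) p prior \<gamma>) (posterior (neg_loglik f z) p prior)
           \<le> ereal (sqrt (\<gamma> * real CARD('n))
                + 2 * (1 - enn2real (eexp (- varrho (neg_loglik f z) p prior g \<gamma>))))"
proof -
  define l where "l = neg_loglik f z"
  have \<gamma>: "0 < \<gamma>" "\<gamma> \<le> \<gamma>\<^sub>0" using gamma by auto
  have wd: "posterior_env_well_defined l p prior \<gamma>"
    using posterior_env_well_defined_antimono[OF prior_nonneg \<gamma> gamma0_wd] unfolding l_def .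
  have l: "convex_on UNIV l" "\<And>x. GDERIV l x :> grad l x" "continuous_on UNIV (grad l)" "continuous_on UNIV l"
    using l_convex C2_grad[OF l_C2] by (simp_all add: l_def)
  have [measurable]: "l \<in> borel_measurable borel" using l(4) by (rule borel_measurable_continuous_onI)
  note [measurable] = p_measurable penalty_measurable[OF p_measurable] envelope_measurable[OF l(4,3)]
  \<comment> \<open>\<open>W\<close> weighs the exact posterior and \<open>u\<close> its Gaussian smearing; \<open>v\<close> weighs the envelope
    posterior.\<close>
  define W where "W \<delta> \<theta> = ennreal (prior \<delta>) * eexp (- objective l p \<delta> \<theta>)" for \<delta> \<theta>
  define v where "v = (\<lambda>(\<delta> :: real ^ 'n, \<theta>). ennreal (prior \<delta> * (2 * pi * \<gamma>) powr (real (norm0 \<delta>) / 2))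
               * eexp (- envelope l p \<gamma> \<delta> \<theta>))"
  define u where "u = (\<lambda>(\<delta> :: real ^ 'n, \<theta>). smeared \<gamma> W \<delta> \<theta>)"
  define R where "R = (\<lambda>(\<delta> :: real ^ 'n, \<theta>). ennreal (exp (remainder l g \<gamma> \<delta> \<theta>)))"
  define k where "k = (2 * pi * \<gamma>) powr (real CARD('n) / 2)"
  have k: "0 < k" using \<gamma> by (simp add: k_def)
  have W: "W \<delta> \<in> borel_measurable borel" for \<delta>
    unfolding W_def objective_def by measurable
  have u: "u \<in> borel_measurable pattern_lborel"
    unfolding u_def by (rule measurable_patternI) (simp add: smeared_measurable W)
  have v: "v \<in> borel_measurable pattern_lborel"
    unfolding v_def by (rule measurable_patternI) simp

  define J where "J = density pattern_lborel u"
  have J: "joint_measure (\<lambda>_. lborel) (smeared \<gamma> W) = J"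
    unfolding J_def u_def by (intro joint_measure_lborel smeared_measurable W)
  define M where "M = normalize_measure J"
  define N where "N = normalize_measure (density pattern_lborel v)"
  have tilde: "posterior_tilde l p prior \<gamma> = M"
  proof -
    have "ennreal (prior \<delta> * (1 / (2 * pi * \<gamma>)) powr ((real CARD('n) - real (norm0 \<delta>)) / 2)
          * exp (- (1 / (2 * \<gamma>)) * (norm (\<theta> - \<theta> * \<delta>))\<^sup>2)) * eexp (- objective l p \<delta> (\<theta> * \<delta>))
        = smeared \<gamma> W \<delta> \<theta>" if "\<delta> \<in> Delta" for \<delta> \<theta> :: "real ^ 'n"
      using that \<gamma> noise_density_eq[OF that \<gamma>(1)] noise_density_nonneg[of \<gamma> \<delta> \<theta>]
      by (simp add: W_def prior_nonneg ennreal_mult'' mult_ac)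
    then show ?thesis
      unfolding posterior_tilde_def M_def J[symmetric] by (intro arg_cong[where f = normalize_measure] joint_measure_cong)
  qed
  have env: "posterior_env l p prior \<gamma> = N"
    unfolding posterior_env_def N_def v_def by (subst joint_measure_lborel) simp_all
  have post: "posterior l p prior = distr M pattern_space project"
  proof -
    have T: "project \<in> J \<rightarrow>\<^sub>M pattern_space" using project_measurable by (simp add: J_def)
    have "posterior l p prior = normalize_measure (joint_measure mu W)"
      by (simp add: posterior_def W_def[abs_def])
    also have "joint_measure mu W = distr J pattern_space project"
      unfolding J[symmetric] by (rule joint_measure_mu_eq_distr[OF W \<gamma>(1)])
    finally show ?thesis by (simp add: normalize_distr[OF T] M_def)
  qed

  have sandwich: "ennreal k * u x \<le> v x" "v x \<le> ennreal k * (u x * R x)" "u x \<noteq> \<infinity>"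
      "0 < prior (fst x) \<Longrightarrow> 0 < u x" if x: "x \<in> space pattern_lborel" for x
  proof -
    obtain \<delta> \<theta> where x': "x = (\<delta>, \<theta>)" and \<delta>: "\<delta> \<in> Delta" using x by auto
    note weights_sandwich[where g = g and \<theta> = \<theta> and p = p, OF l(1,2) \<delta> \<gamma>(1) prior_nonneg[OF \<delta>]
      P_subgradient[OF \<delta> restrict_in_Rsub]]
    then show "ennreal k * u x \<le> v x" "v x \<le> ennreal k * (u x * R x)" "u x \<noteq> \<infinity>"
      "0 < prior (fst x) \<Longrightarrow> 0 < u x"
      by (simp_all add: u_def v_def k_def R_def W_def x')
  qed

  \<comment> \<open>Both measures have positive finite mass: \<open>v\<close> is integrable by well-definedness, and \<open>u\<close> is
    positive everywhere on any pattern of positive prior probability.\<close>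
  have mass_v: "(\<integral>\<^sup>+ x. v x \<partial>pattern_lborel) \<noteq> \<infinity>"
    using wd v unfolding posterior_env_well_defined_def
    by (simp add: nn_integral_pattern v_def nn_integral_cmult)
  have mass_u: "(\<integral>\<^sup>+ x. u x \<partial>pattern_lborel) \<noteq> 0"
  proof
    assume zero: "(\<integral>\<^sup>+ x. u x \<partial>pattern_lborel) = 0"
    obtain \<delta> where \<delta>: "\<delta> \<in> Delta" "prior \<delta> \<noteq> 0"
      using prior_sum by (metis sum.neutral zero_neq_one)
    then have pos: "0 < prior \<delta>" using prior_nonneg by (simp add: less_le)
    have "(\<integral>\<^sup>+ \<theta>. u (\<delta>, \<theta>) \<partial>lborel) = 0"
      using zero \<delta>(1) u by (simp add: nn_integral_pattern finite_Delta)
    then have "AE \<theta> in lborel. u (\<delta>, \<theta>) = 0"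
      using measurable_patternD[OF u \<delta>(1)] by (subst (asm) nn_integral_0_iff_AE) auto
    moreover have "u (\<delta>, \<theta>) \<noteq> 0" for \<theta>
      using sandwich(4)[of "(\<delta>, \<theta>)"] \<delta>(1) pos by auto
    ultimately have "AE \<theta> :: real ^ 'n in lborel. False" by simp
    then show False by (simp add: ae_filter_eq_bot_iff eventually_False)
  qed
  obtain t where t: "0 \<le> t" "1 \<le> ennreal t * (\<integral>\<^sup>+ x. R x \<partial>M)"
    and minor: "\<And>F. F \<in> borel_measurable pattern_lborel \<Longrightarrow>
      ennreal t * (\<integral>\<^sup>+ x. F x \<partial>M) \<le> (\<integral>\<^sup>+ x. F x \<partial>N)"
    unfolding M_def N_def J_def
    by (rule density_sandwich_minorant[OF u v k sandwich(3,1,2) mass_u mass_v]) blast+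
  have rho: "enn2real (eexp (- varrho l p prior g \<gamma>)) \<le> t"
    unfolding varrho_def tilde using t by (intro exp_neg_elog_le) (simp_all add: R_def)

  have "ennreal k * (\<integral>\<^sup>+ x. u x \<partial>pattern_lborel) \<le> (\<integral>\<^sup>+ x. v x \<partial>pattern_lborel)"
    using u sandwich(1) by (subst nn_integral_cmult[symmetric]) (auto intro!: nn_integral_mono)
  then have mass_u': "(\<integral>\<^sup>+ x. u x \<partial>pattern_lborel) \<noteq> \<infinity>" and mass_v': "(\<integral>\<^sup>+ x. v x \<partial>pattern_lborel) \<noteq> 0"
    using mass_u mass_v k by (auto simp: top_unique ennreal_mult_eq_top_iff)
  note mass = emeasure_density_whole[OF u] emeasure_density_whole[OF v]
  have prob_M: "prob_space M" and prob_N: "prob_space N"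
    unfolding M_def N_def J_def
    using mass_u mass_u' mass_v mass_v' mass by (auto intro!: prob_space_normalize)
  have sets_M: "sets M = sets pattern_space" and sets_N: "sets N = sets pattern_space"
    by (simp_all add: M_def N_def J_def)
  have space_M: "space M = Delta \<times> UNIV" and space_N: "space N = Delta \<times> UNIV"
    by (simp_all add: M_def N_def J_def space_pair_measure)
  have meas_M: "M \<rightarrow>\<^sub>M K = pattern_lborel \<rightarrow>\<^sub>M K" for K :: "'c measure"
    by (rule measurable_cong_sets) (simp_all add: sets_M)

  \<comment> \<open>The displacement of the coupling and its second moment.\<close>
  define s where "s = sqrt (\<gamma> * real CARD('n))"
  have s: "0 < s" "s\<^sup>2 = \<gamma> * real CARD('n)" using \<gamma> by (simp_all add: s_def)
  define D :: "(real ^ 'n) \<times> (real ^ 'n) \<Rightarrow> real" where "D = (\<lambda>(\<delta>, \<theta>). norm (\<theta> - \<theta> * \<delta>))"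
  have D: "D \<in> borel_measurable pattern_lborel"
    unfolding D_def by (rule displacement_measurable)
  have moment: "(\<integral>\<^sup>+ x. ennreal ((D x)\<^sup>2) \<partial>M) \<le> ennreal (s\<^sup>2)"
  proof -
    have "(\<integral>\<^sup>+ x. ennreal ((D x)\<^sup>2) \<partial>M) = inverse (emeasure J (space J)) * (\<integral>\<^sup>+ x. ennreal ((D x)\<^sup>2) \<partial>J)"
      unfolding M_def using D by (intro nn_integral_normalize) (simp add: J_def)
    also have "\<dots> \<le> inverse (emeasure J (space J)) * (ennreal (s\<^sup>2) * emeasure J (space J))"
      using smeared_second_moment[where W = W, OF W \<gamma>(1)] unfolding J s(2) D_def by (rule mult_left_mono) simp
    also have "\<dots> = ennreal (s\<^sup>2) * (emeasure J (space J) / emeasure J (space J))"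
      by (simp add: divide_ennreal_def mult_ac)
    also have "\<dots> = ennreal (s\<^sup>2)"
      using mass_u mass_u' mass by (simp add: J_def ennreal_divide_self less_top zero_less_iff_neq_zero)
    finally show ?thesis .
  qed

  have "ereal \<bar>integral\<^sup>L N \<phi> - integral\<^sup>L (distr M pattern_space project) \<phi>\<bar> \<le> ereal (s + 2 * (1 - enn2real (eexp (- varrho l p prior g \<gamma>))))"
    if "\<phi> \<in> borel_measurable N" and test: "sup_norm_on (space N) \<phi> + lipschitz_const pair_dist (space N) \<phi> \<le> 1"
    for \<phi> :: "(real ^ 'n) \<times> (real ^ 'n) \<Rightarrow> real"
  proof -
    have \<phi>: "\<phi> \<in> borel_measurable pattern_lborel"
      using that(1) by (simp add: N_def)
    have \<phi>_M: "\<phi> \<in> borel_measurable M" using \<phi> by (simp add: meas_M)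
    have bound: "\<bar>\<phi> x\<bar> \<le> 1" if "x \<in> space M" for x
      using bounded_lipschitz_testD(1)[OF test] that by (simp add: space_M space_N)
    have lip: "\<bar>\<phi> x - \<phi> (project x)\<bar> \<le> D x" if "x \<in> space M" for x
    proof -
      obtain \<delta> \<theta> where x: "x = (\<delta>, \<theta>)" "\<delta> \<in> Delta" using \<open>x \<in> space M\<close> by (auto simp: space_M)
      have dist: "pair_dist (\<delta>, \<theta>) (\<delta>, \<theta> * \<delta>) = norm (\<theta> - \<theta> * \<delta>)"
        by (simp add: pair_dist_def norm0_def)
      have "\<bar>\<phi> (\<delta>, \<theta>) - \<phi> (\<delta>, \<theta> * \<delta>)\<bar> \<le> pair_dist (\<delta>, \<theta>) (\<delta>, \<theta> * \<delta>)"
        using x(2) by (intro bounded_lipschitz_testD(2)[OF test]) (auto simp: space_N dist)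
      then show ?thesis by (simp add: x D_def dist)
    qed
    \<comment> \<open>The triangle inequality through \<open>M\<close>, the measure \<^const>\<open>posterior_tilde\<close>.\<close>
    have "\<bar>(\<integral> x. \<phi> x \<partial>N) - (\<integral> x. \<phi> x \<partial>M)\<bar> \<le> 2 * (1 - t)"
      using minor by (intro expectation_diff_le_of_minorant prob_M prob_N \<phi>_M bound t) (auto simp: sets_M sets_N meas_M)
    moreover have "\<bar>(\<integral> x. \<phi> x \<partial>M) - (\<integral> x. \<phi> (project x) \<partial>M)\<bar> \<le> s"
    proof (rule expectation_displacement_le[OF prob_M _ \<phi>_M bound lip _ s(1) moment])
      show "project \<in> M \<rightarrow>\<^sub>M M"
        using project_measurable measurable_cong_sets[of M pattern_lborel M pattern_space]
        by (simp add: sets_M)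
      show "D \<in> borel_measurable M" using D by (simp add: meas_M)
    qed
    moreover have "integral\<^sup>L (distr M pattern_space project) \<phi> = (\<integral> x. \<phi> (project x) \<partial>M)"
    proof (rule integral_distr)
      show "project \<in> M \<rightarrow>\<^sub>M pattern_space" using project_measurable by (simp add: meas_M)
      show "\<phi> \<in> borel_measurable pattern_space"
        using \<phi> measurable_cong_sets[OF sets_pattern_lborel refl] by blast
    qed
    ultimately show ?thesis using rho by simp
  qed
  then show ?thesis
    using wd unfolding bounded_lipschitz_dist_def l_def[symmetric] env post s_def[symmetric]
    by (auto intro!: SUP_least)
qed

end
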